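(* Let $f(x)\in\mathbb{Z}[x]$ be a polynomial of the form $f(x)=x^d+A\cdot h(x)$, where $A\in\mathbb{Z}$, $h(x)\in\mathbb{Z}[x]$, $d>1$, $|h(0)|=1$ and $\deg h(x)<d$. Let $k$ be a positive integer such that $f(x^k)$ is irreducible over $\mathbb{Q}$. Then $f(x^k)$ is monogenic if and only if (1) $f(x)$ is monogenic, and (2) for every prime $p$ dividing $k$, the polynomial $\frac{1}{p}\big(A\cdot h(x^p)+(-A\cdot h(x))^p\big)$ (which has integer coefficients) is coprime to $f(x)$ modulo $p$, i.e. their reductions modulo $p$ are coprime in $\mathbb{F}_p[x]$.
   Context: For a monic irreducible polynomial $g(x)\in\mathbb{Z}[x]$ with a root $\theta$ and $K=\mathbb{Q}(\theta)$ with ring of integers $\mathbb{Z}_K$, the index of $g$ is $[\mathbb{Z}_K:\mathbb{Z}[\theta]]$, and $g$ is monogenic if this index is $1$. *)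

theory Defs
  imports
    "HOL-Computational_Algebra.Computational_Algebra"
    "Berlekamp_Zassenhaus.Poly_Mod"
begin

text \<open>The number field \<open>\<rat>(\<theta>)\<close>, realised inside the complex numbers.\<close>

definition rat_adjoin :: "complex \<Rightarrow> complex set" where
  "rat_adjoin \<theta> =
     {poly (map_poly of_rat a) \<theta> / poly (map_poly of_rat b) \<theta> | (a :: rat poly) (b :: rat poly).
        poly (map_poly of_rat b) \<theta> \<noteq> 0}"

definition ring_of_integers :: "complex set \<Rightarrow> complex set" where
  "ring_of_integers K = {x \<in> K. algebraic_int x}"

definition int_adjoin :: "complex \<Rightarrow> complex set" where
  "int_adjoin \<theta> = {poly (map_poly of_int q) \<theta> | q :: int poly. True}"

text \<open>The number of additive cosets of \<open>H\<close> by elements of \<open>G\<close>, for additive subgroups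
  \<open>H \<subseteq> G\<close>. An infinite index would be rendered as 0, and so is never confused with index 1.\<close>

definition add_index :: "complex set \<Rightarrow> complex set \<Rightarrow> nat" where
  "add_index G H = card ((\<lambda>x. (\<lambda>y. x + y) ` H) ` G)"

text \<open>The index does not depend on the chosen root, since the fields generated by two
  roots of an irreducible polynomial are isomorphic over \<open>\<rat>\<close>.\<close>

definition monogenic :: "int poly \<Rightarrow> bool" where
  "monogenic g \<longleftrightarrow> lead_coeff g = 1 \<and> irreducible g \<and>
     (\<exists>\<theta> :: complex. poly (map_poly of_int g) \<theta> = 0 \<and>
        add_index (ring_of_integers (rat_adjoin \<theta>)) (int_adjoin \<theta>) = 1)"

definition subst_power :: "int poly \<Rightarrow> nat \<Rightarrow> int poly" where
  "subst_power g n = pcompose g (monom 1 n)"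

definition test_numerator :: "int \<Rightarrow> int poly \<Rightarrow> nat \<Rightarrow> int poly" where
  "test_numerator A h p = smult A (subst_power h p) + (- smult A h) ^ p"

text \<open>Division by \<open>p\<close> is taken coefficientwise in the integers. It is exact for prime \<open>p\<close>,
  because then \<open>p\<close> divides every coefficient of the numerator.\<close>

definition test_poly :: "int \<Rightarrow> int poly \<Rightarrow> nat \<Rightarrow> int poly" where
  "test_poly A h p = map_poly (\<lambda>c. c div int p) (test_numerator A h p)"

end

(*
  Z[theta] = Z[x]/(g) is integrally closed iff g lies in no square m^2 of a maximal ideal m of Z[x]
  (Dedekind's criterion in Uchida's form). Every such m is (p, phi) with p prime and phi monic and
  irreducible mod p, so the question splits into one about each prime p.

  If p divides k, write k = p n. The test polynomial t satisfies f(x^p) = f(x)^p + p t(x) - p f(x) s(x)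
  for some s, hence f(x^k) = f(x^n)^p + p t(x^n) - p f(x^n) s(x^n). A maximal ideal m over p that contains
  f(x^k) contains f(x^n), so f(x^k) lies in m^2 iff p t(x^n) does, iff t(x^n) lies in m. Such an m
  exists iff f and t have a common factor mod p.

  If p does not divide k, the map x -> x^k is etale away from x = 0, so a singularity of f(x^k)
  there comes from one of f; at x = 0 the condition |h(0)| = 1 forces p^2 | A, and then f itself is
  singular. Conversely a singularity of f always lifts to one of f(x^k).
*)
theory Submission
  imports Defs "Jordan_Normal_Form.Char_Poly"
begin

section \<open>Ideals of \<open>\<int>[x]\<close> above a prime\<close>

hide_const (open) Module.smult

text \<open>Products with the constant polynomial \<open>[:p:]\<close> must not be turned into \<open>smult\<close>, so that
  \<open>algebra_simps\<close> can treat \<open>[:p:]\<close> as a generator of the ideals below.\<close>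

declare mult_pCons_left [simp del] mult_pCons_right [simp del]

text \<open>Everything is phrased as membership in ideals of Z[x] above a fixed p, with explicit
  cofactors; F_p[x], residue fields and local rings are never formed. Vanishing modulo p is
  divisibility by \<open>[:p:]\<close>, and monic representatives keep division with remainder
  integral. Uchida's form suits substitution: x -> x^n carries m^2 into the square of every maximal
  ideal that contains p and \<phi>(x^n), however \<phi>(x^n) factors modulo p. The test polynomial
  is, up to multiples of f, the quotient (f(x^p) - f^p)/p, which measures how far f is from
  commuting with the Frobenius lift x -> x^p; this is where the division by p comes from. In
  Dedekind's criterion, g in m^2 yields an explicit integral element outside Z[\<theta>] that
  multiplies the image of m into itself. Conversely, a given such element is first scaled until p
  and \<phi>(\<theta>) both carry it into Z[\<theta>].\<close>

definition poly_ideal :: "int poly set \<Rightarrow> bool" where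
  "poly_ideal I \<longleftrightarrow> 0 \<in> I \<and> (\<forall>u\<in>I. \<forall>v\<in>I. u + v \<in> I) \<and> (\<forall>u\<in>I. \<forall>c. c * u \<in> I)"

definition ideal_pair :: "int \<Rightarrow> int poly \<Rightarrow> int poly set" where
  "ideal_pair p \<phi> = {[:p:] * a + \<phi> * b | a b. True}"

definition ideal_pair_sq :: "int \<Rightarrow> int poly \<Rightarrow> int poly set" where
  "ideal_pair_sq p \<phi> = {\<phi> * \<phi> * a + [:p:] * \<phi> * b + [:p:] * [:p:] * c | a b c. True}"

text \<open>The last clause makes the quotient by \<open>(p, \<phi>)\<close> a field. It is stated
  through inverses because maximality is used in that form; irreducibility of \<open>\<phi>\<close>
  modulo p stays implicit.\<close>

definition maximal_pair :: "int \<Rightarrow> int poly \<Rightarrow> bool" where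
  "maximal_pair p \<phi> \<longleftrightarrow> prime p \<and> lead_coeff \<phi> = 1 \<and> 1 \<notin> ideal_pair p \<phi> \<and>
     (\<forall>u. u \<notin> ideal_pair p \<phi> \<longrightarrow> (\<exists>c. 1 - u * c \<in> ideal_pair p \<phi>))"

lemma ideal_pairI: "u = [:p:] * a + \<phi> * b \<Longrightarrow> u \<in> ideal_pair p \<phi>"
  unfolding ideal_pair_def by blast

lemma ideal_pairE:
  assumes "u \<in> ideal_pair p \<phi>" obtains a b where "u = [:p:] * a + \<phi> * b"
  using assms unfolding ideal_pair_def by blast

lemma ideal_pair_sqI:
  "u = \<phi> * \<phi> * a + [:p:] * \<phi> * b + [:p:] * [:p:] * c \<Longrightarrow> u \<in> ideal_pair_sq p \<phi>"
  unfolding ideal_pair_sq_def by blast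

lemma ideal_pair_sqE:
  assumes "u \<in> ideal_pair_sq p \<phi>"
  obtains a b c where "u = \<phi> * \<phi> * a + [:p:] * \<phi> * b + [:p:] * [:p:] * c"
  using assms unfolding ideal_pair_sq_def by blast

lemma poly_ideal_0: "poly_ideal I \<Longrightarrow> 0 \<in> I"
  and poly_ideal_add: "poly_ideal I \<Longrightarrow> u \<in> I \<Longrightarrow> v \<in> I \<Longrightarrow> u + v \<in> I"
  and poly_ideal_mult: "poly_ideal I \<Longrightarrow> u \<in> I \<Longrightarrow> c * u \<in> I"
  and poly_ideal_mult2: "poly_ideal I \<Longrightarrow> u \<in> I \<Longrightarrow> u * c \<in> I"
  unfolding poly_ideal_def by (auto simp: mult.commute)

lemma poly_ideal_diff:
  assumes "poly_ideal I" "u \<in> I" "v \<in> I" shows "u - v \<in> I"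
  using poly_ideal_add[OF assms(1,2) poly_ideal_mult[OF assms(1,3), of "-1"]] by simp

lemma poly_ideal_pair: "poly_ideal (ideal_pair p \<phi>)"
  unfolding poly_ideal_def
proof (intro conjI ballI allI)
  show "0 \<in> ideal_pair p \<phi>" by (rule ideal_pairI[of _ _ 0 _ 0]) simp
next
  fix u v assume "u \<in> ideal_pair p \<phi>" "v \<in> ideal_pair p \<phi>"
  then obtain a b a' b' where "u = [:p:] * a + \<phi> * b" "v = [:p:] * a' + \<phi> * b'"
    by (elim ideal_pairE)
  then show "u + v \<in> ideal_pair p \<phi>"
    by (intro ideal_pairI[of _ _ "a + a'" _ "b + b'"]) (simp only: algebra_simps)
next
  fix u c assume "u \<in> ideal_pair p \<phi>"
  then obtain a b where "u = [:p:] * a + \<phi> * b" by (elim ideal_pairE)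
  then show "c * u \<in> ideal_pair p \<phi>"
    by (intro ideal_pairI[of _ _ "c * a" _ "c * b"]) (simp only: algebra_simps)
qed

lemma poly_ideal_pair_sq: "poly_ideal (ideal_pair_sq p \<phi>)"
  unfolding poly_ideal_def
proof (intro conjI ballI allI)
  show "0 \<in> ideal_pair_sq p \<phi>" by (rule ideal_pair_sqI[of _ _ 0 _ 0 0]) simp
next
  fix u v assume "u \<in> ideal_pair_sq p \<phi>" "v \<in> ideal_pair_sq p \<phi>"
  then obtain a b c a' b' c' where "u = \<phi> * \<phi> * a + [:p:] * \<phi> * b + [:p:] * [:p:] * c"
    "v = \<phi> * \<phi> * a' + [:p:] * \<phi> * b' + [:p:] * [:p:] * c'"
    by (elim ideal_pair_sqE)
  then show "u + v \<in> ideal_pair_sq p \<phi>"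
    by (intro ideal_pair_sqI[of _ _ "a + a'" _ "b + b'" "c + c'"]) (simp only: algebra_simps)
next
  fix u d assume "u \<in> ideal_pair_sq p \<phi>"
  then obtain a b c where "u = \<phi> * \<phi> * a + [:p:] * \<phi> * b + [:p:] * [:p:] * c" by (elim ideal_pair_sqE)
  then show "d * u \<in> ideal_pair_sq p \<phi>"
    by (intro ideal_pair_sqI[of _ _ "d * a" _ "d * b" "d * c"]) (simp only: algebra_simps)
qed

lemma p_in_ideal_pair: "[:p:] \<in> ideal_pair p \<phi>"
  by (rule ideal_pairI[of _ _ 1 _ 0]) simp

lemma phi_in_ideal_pair: "\<phi> \<in> ideal_pair p \<phi>"
  by (rule ideal_pairI[of _ _ 0 _ 1]) simp

lemma ideal_pair_subset:
  assumes "poly_ideal I" "[:p:] \<in> I" "v \<in> I" shows "ideal_pair p v \<subseteq> I"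
proof
  fix u assume "u \<in> ideal_pair p v"
  then obtain a b where u: "u = [:p:] * a + v * b" by (elim ideal_pairE)
  show "u \<in> I"
    unfolding u using assms by (intro poly_ideal_add poly_ideal_mult2)
qed

lemma mult_in_ideal_pair_sq:
  assumes "u \<in> ideal_pair p \<phi>" "v \<in> ideal_pair p \<phi>"
  shows "u * v \<in> ideal_pair_sq p \<phi>"
proof -
  obtain a b a' b' where "u = [:p:] * a + \<phi> * b" "v = [:p:] * a' + \<phi> * b'"
    using assms by (elim ideal_pairE)
  then show ?thesis
    by (intro ideal_pair_sqI[of _ _ "b * b'" _ "a * b' + a' * b" "a * a'"]) (simp only: algebra_simps)
qed

lemma ideal_pair_sq_subset_pair: "ideal_pair_sq p \<phi> \<subseteq> ideal_pair p \<phi>"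
proof
  fix u assume "u \<in> ideal_pair_sq p \<phi>"
  then obtain a b c where u: "u = \<phi> * \<phi> * a + [:p:] * \<phi> * b + [:p:] * [:p:] * c"
    by (elim ideal_pair_sqE)
  show "u \<in> ideal_pair p \<phi>"
    unfolding u by (rule ideal_pairI[of _ _ "\<phi> * b + [:p:] * c" _ "\<phi> * a"]) (simp only: algebra_simps)
qed

section \<open>Division with remainder and principal ideals modulo p\<close>

lemma prime_const_poly: "prime (p :: int) \<Longrightarrow> prime_elem [:p:]"
  unfolding prime_elem_const_poly_iff prime_def by blast

lemma not_prime_dvd_monic:
  assumes "prime (p :: int)" "lead_coeff u = 1" shows "\<not> [:p:] dvd u"
  using assms by (metis const_poly_dvd_iff not_prime_unit)

text \<open>Pseudo-division scales the dividend by a power of the leading coefficient of the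
  divisor, which is 1 here.\<close>

lemma monic_divide:
  fixes v :: "int poly" assumes "lead_coeff v = 1"
  obtains q r where "u = v * q + r" "r = 0 \<or> degree r < degree v"
proof -
  obtain q r where qr: "pseudo_divmod u v = (q, r)" by (rule prod.exhaust)
  have "v \<noteq> 0" using assms by auto
  note * = pseudo_divmod[OF this qr]
  have "u = v * q + r" using *(1) unfolding assms by simp
  then show ?thesis using *(2) by (rule that)
qed

lemma dvd_of_dvd_mult_monic:
  assumes "prime (p :: int)" "lead_coeff u = 1" "[:p:] dvd u * v" shows "[:p:] dvd v"
  using prime_elem_dvd_multD[OF prime_const_poly[OF assms(1)] assms(3)]
    not_prime_dvd_monic[OF assms(1,2)] by simp

text \<open>This is the statement that \<open>\<int>[x]/(p)\<close> is a principal ideal domain.\<close>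

lemma poly_ideal_mod_prime_principal:
  assumes I: "poly_ideal I" and p: "prime (p :: int)" "[:p:] \<in> I" and u: "u \<in> I" "\<not> [:p:] dvd u"
  obtains v where "lead_coeff v = 1" "I = ideal_pair p v"
proof -
  let ?Q = "\<lambda>u. u \<in> I \<and> \<not> [:p:] dvd u"
  define w where "w = (ARG_MIN degree u. ?Q u)"
  have w: "?Q w" unfolding w_def using u by (intro arg_min_natI[of ?Q u degree]) auto
  have w_min: "degree w \<le> degree y" if "?Q y" for y
    unfolding w_def using that by (rule arg_min_nat_le)
  define n where "n = degree w"
  have pI: "[:p:] * c \<in> I" for c using poly_ideal_mult2[OF I p(2)] .
  have "\<not> p dvd lead_coeff w"
  proof
    assume "p dvd lead_coeff w"
    then obtain c where c: "lead_coeff w = p * c" by auto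
    define y where "y = w - [:p:] * monom c n"
    have "w = y + [:p:] * monom c n" unfolding y_def by simp
    then have "\<not> [:p:] dvd y" using w by (metis dvd_add dvd_triv_left)
    moreover have "y \<in> I" unfolding y_def using w pI[of "monom c n"] by (intro poly_ideal_diff[OF I]) auto
    ultimately have y: "?Q y" by blast
    have cy: "coeff y n = 0" unfolding y_def using c by (simp add: n_def mult_pCons_left)
    have "degree y \<le> n" unfolding y_def
      by (rule degree_diff_le) (auto simp: n_def mult_pCons_left smult_monom degree_monom_le)
    moreover have "degree y \<noteq> n"
      using cy y by (metis leading_coeff_0_iff dvd_0_right)
    ultimately show False using w_min[OF y] n_def by simp
  qed
  then have "Rings.coprime p (lead_coeff w)" using p(1) by (simp add: prime_imp_coprime)
  then have "gcd p (lead_coeff w) = 1" by (rule coprime_imp_gcd_eq_1)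
  then obtain r s where rs: "r * p + s * lead_coeff w = 1"
    using bezout_coefficients_fst_snd[of p "lead_coeff w"] by (intro that) (erule trans)
  \<comment> \<open>The Bezout identity \<open>rs\<close> makes the leading coefficient equal to 1
    over the integers, not merely a unit modulo p.\<close>
  define v where "v = [:s:] * w + [:p:] * monom r n"
  have vI: "v \<in> I" unfolding v_def
    by (rule poly_ideal_add[OF I poly_ideal_mult[OF I conjunct1[OF w]] pI])
  have cv: "coeff v n = 1" unfolding v_def using rs by (simp add: n_def mult_pCons_left algebra_simps mult_pCons_right)
  have "degree v \<le> n" unfolding v_def
    by (rule degree_add_le) (auto simp: n_def mult_pCons_left smult_monom degree_monom_le)
  then have dv: "degree v = n" using cv by (metis le_antisym le_degree zero_neq_one)
  have lv: "lead_coeff v = 1" using cv dv by simp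
  have "I \<subseteq> ideal_pair p v"
  proof
    fix e assume e: "e \<in> I"
    obtain q r where qr: "e = v * q + r" "r = 0 \<or> degree r < degree v" using monic_divide[OF lv] .
    have "r = e - v * q" using qr by simp
    then have "r \<in> I" using poly_ideal_diff[OF I e poly_ideal_mult2[OF I vI]] by metis
    then have "[:p:] dvd r" using w_min[of r] qr(2) dv n_def by (cases "r = 0") auto
    then obtain c where "r = [:p:] * c" by (elim dvdE)
    then have "e = [:p:] * c + v * q" using qr(1) by (simp only: add.commute)
    then show "e \<in> ideal_pair p v" by (rule ideal_pairI)
  qed
  then have "I = ideal_pair p v" using ideal_pair_subset[OF I p(2) vI] by blast
  then show ?thesis using that lv by blast
qed

text \<open>Remainders modulo a monic polynomial are unique: once \<open>a\<close> is reduced to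
  \<open>r\<close> modulo \<open>v\<close>, the difference \<open>e - [:p:] * r\<close> is a
  multiple of \<open>v\<close> of smaller degree, hence zero. This stands in for comparing degrees
  in F_p[x].\<close>

lemma ideal_pair_small_degree:
  assumes p: "prime (p :: int)" and v: "lead_coeff v = 1"
    and e: "e \<in> ideal_pair p v" "e = 0 \<or> degree e < degree v"
  shows "[:p:] dvd e"
proof -
  obtain a b where ab: "e = [:p:] * a + v * b" using e(1) by (elim ideal_pairE)
  obtain q r where qr: "a = v * q + r" "r = 0 \<or> degree r < degree v" using monic_divide[OF v] .
  have eq: "v * ([:p:] * q + b) = e - [:p:] * r" using ab qr(1) by (simp only: algebra_simps)
  have "degree ([:p:] * r) \<le> degree r" by (simp add: mult_pCons_left degree_smult_le)
  then have *: "e - [:p:] * r = 0 \<or> degree (e - [:p:] * r) < degree v"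
    using qr(2) e(2) degree_diff_le_max[of e "[:p:] * r"] by auto
  have "[:p:] * q + b = 0"
  proof (rule ccontr)
    assume **: "[:p:] * q + b \<noteq> 0"
    have "v \<noteq> 0" using v by auto
    then have "v * ([:p:] * q + b) \<noteq> 0" "degree v \<le> degree (v * ([:p:] * q + b))"
      using ** degree_mult_eq[of v "[:p:] * q + b"] by (simp_all only: mult_eq_0_iff simp_thms le_add1)
    then show False using * unfolding eq by linarith
  qed
  then have "e = [:p:] * r" using eq by (simp only: mult_zero_right) algebra
  then show ?thesis by (metis dvd_triv_left)
qed

lemma one_in_ideal_pair_iff:
  assumes "prime (p :: int)" "lead_coeff v = 1"
  shows "1 \<in> ideal_pair p v \<longleftrightarrow> degree v = 0"
proof
  assume "1 \<in> ideal_pair p v"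
  then show "degree v = 0"
    using ideal_pair_small_degree[OF assms] not_prime_dvd_monic[OF assms(1), of 1] by force
next
  assume "degree v = 0"
  then have "v = 1" using assms(2) monic_degree_0 by blast
  then show "1 \<in> ideal_pair p v" using phi_in_ideal_pair by metis
qed

section \<open>Maximal ideals above p\<close>

lemma maximal_pairD:
  assumes "maximal_pair p \<phi>"
  shows "prime p" "lead_coeff \<phi> = 1" "1 \<notin> ideal_pair p \<phi>" "degree \<phi> > 0"
  using assms one_in_ideal_pair_iff unfolding maximal_pair_def by auto

lemma maximal_pair_prime:
  assumes m: "maximal_pair p \<phi>" and uv: "u * v \<in> ideal_pair p \<phi>" and u: "u \<notin> ideal_pair p \<phi>"
  shows "v \<in> ideal_pair p \<phi>"
proof -
  note I = poly_ideal_pair[of p \<phi>]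
  obtain c where c: "1 - u * c \<in> ideal_pair p \<phi>" using m u unfolding maximal_pair_def by blast
  have "v = v * (1 - u * c) + c * (u * v)" by (simp only: algebra_simps)
  also have "\<dots> \<in> ideal_pair p \<phi>"
    by (intro poly_ideal_add[OF I] poly_ideal_mult[OF I c] poly_ideal_mult[OF I uv])
  finally show ?thesis .
qed

lemma maximal_pair_power:
  assumes m: "maximal_pair p \<phi>" and "u ^ n \<in> ideal_pair p \<phi>"
  shows "u \<in> ideal_pair p \<phi>"
  using assms(2)
proof (induction n)
  case 0 then show ?case using maximal_pairD(3)[OF m] by simp
next
  case (Suc n) then show ?case using maximal_pair_prime[OF m, of u "u ^ n"] by auto
qed

lemma poly_ideal_adjoin:
  assumes I: "poly_ideal I" shows "poly_ideal {u * c + e | c e. e \<in> I}"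
  unfolding poly_ideal_def
proof (intro conjI ballI allI)
  show "0 \<in> {u * c + e | c e. e \<in> I}" 
    using poly_ideal_0[OF I] by (intro CollectI exI[of _ 0]) simp
next
  fix v w assume "v \<in> {u * c + e | c e. e \<in> I}" "w \<in> {u * c + e | c e. e \<in> I}"
  then obtain c e c' e' where "v = u * c + e" "e \<in> I" "w = u * c' + e'" "e' \<in> I" by blast
  moreover from this have "v + w = u * (c + c') + (e + e')" by (simp only: algebra_simps)
  ultimately show "v + w \<in> {u * c + e | c e. e \<in> I}" using poly_ideal_add[OF I] by blast
next
  fix v d assume "v \<in> {u * c + e | c e. e \<in> I}"
  then obtain c e where "v = u * c + e" "e \<in> I" by blast
  moreover from this have "d * v = u * (d * c) + d * e" by (simp only: algebra_simps)
  ultimately show "d * v \<in> {u * c + e | c e. e \<in> I}" using poly_ideal_mult[OF I] by blast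
qed

text \<open>Invertibility of \<open>u\<close> modulo \<open>(p, \<phi>)\<close> means that 1 lies in
  the enlarged ideal. Both maximality proofs below study that ideal through its generator
  \<open>v\<close>.\<close>

lemma ideal_pair_adjoin:
  assumes "prime (p :: int)" "lead_coeff \<phi> = 1"
  obtains v where "lead_coeff v = 1" "{u * c + e | c e. e \<in> ideal_pair p \<phi>} = ideal_pair p v"
    "ideal_pair p \<phi> \<subseteq> ideal_pair p v" "u \<in> ideal_pair p v"
proof -
  let ?K = "{u * c + e | c e. e \<in> ideal_pair p \<phi>}"
  note I = poly_ideal_pair[of p \<phi>]
  have sub: "ideal_pair p \<phi> \<subseteq> ?K"
  proof
    fix x assume "x \<in> ideal_pair p \<phi>"
    moreover have "x = u * 0 + x" by simp
    ultimately show "x \<in> ?K" by blast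
  qed
  have u: "u \<in> ?K" using poly_ideal_0[OF I] by (intro CollectI exI[of _ 1] exI[of _ 0]) simp
  obtain v where "lead_coeff v = 1" "?K = ideal_pair p v"
    using poly_ideal_mod_prime_principal[OF poly_ideal_adjoin[OF I, of u] assms(1), of \<phi>]
      sub p_in_ideal_pair phi_in_ideal_pair not_prime_dvd_monic[OF assms] by blast
  then show ?thesis using sub u that by blast
qed

text \<open>Nonzero prime ideals of the principal ideal domain F_p[x] are maximal; the monic
  \<open>w\<close> excludes the zero ideal. If \<open>v\<close> generates the ideal enlarged by an
  outside \<open>u\<close>, then \<open>\<phi> = v b\<close> modulo p with \<open>b\<close> in
  \<open>I\<close>, so \<open>\<phi>\<close> divides \<open>b\<close> and \<open>v\<close> is a unit
  modulo p.\<close>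

lemma prime_ideal_maximal_pair:
  assumes I: "poly_ideal I" and p: "prime (p :: int)" "[:p:] \<in> I" and one: "1 \<notin> I"
    and prime: "\<And>u v. u * v \<in> I \<Longrightarrow> u \<in> I \<or> v \<in> I" and w: "w \<in> I" "lead_coeff w = 1"
  obtains \<phi> where "maximal_pair p \<phi>" "I = ideal_pair p \<phi>"
proof -
  obtain \<phi> where \<phi>: "lead_coeff \<phi> = 1" "I = ideal_pair p \<phi>"
    using poly_ideal_mod_prime_principal[OF I p w(1) not_prime_dvd_monic[OF p(1) w(2)]] .
  have "\<exists>c. 1 - u * c \<in> I" if u: "u \<notin> I" for u
  proof -
    obtain v where v: "lead_coeff v = 1" "{u * c + e | c e. e \<in> I} = ideal_pair p v"
      "I \<subseteq> ideal_pair p v" "u \<in> ideal_pair p v"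
      using ideal_pair_adjoin[OF p(1) \<phi>(1), of u] unfolding \<phi>(2) by blast
    have "\<phi> \<in> ideal_pair p v" using v(3) \<phi>(2) phi_in_ideal_pair by blast
    then obtain a b where ab: "\<phi> = [:p:] * a + v * b" by (elim ideal_pairE)
    have "v * b = \<phi> - [:p:] * a" unfolding ab by simp
    then have "v * b \<in> I"
      using poly_ideal_diff[OF I _ poly_ideal_mult2[OF I p(2)]] \<phi>(2) phi_in_ideal_pair by metis
    moreover have "v \<notin> I" using ideal_pair_subset[OF I p(2)] v(4) u by blast
    ultimately have "b \<in> ideal_pair p \<phi>" using prime \<phi>(2) by blast
    then obtain c e where ce: "b = [:p:] * c + \<phi> * e" by (elim ideal_pairE)
    have "\<phi> * (1 - v * e) = \<phi> - v * (b - [:p:] * c)" unfolding ce by (simp only: algebra_simps)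
    also have "\<dots> = [:p:] * (a + v * c)" by (subst ab) (simp only: algebra_simps)
    finally have "[:p:] dvd 1 - v * e"
      using dvd_of_dvd_mult_monic[OF p(1) \<phi>(1)] by (metis dvd_triv_left)
    then obtain d where "1 - v * e = [:p:] * d" by (elim dvdE)
    then have "1 = [:p:] * d + v * e" by (simp only: diff_eq_eq)
    then have "1 \<in> {u * c + e | c e. e \<in> I}" unfolding v(2) by (rule ideal_pairI)
    then obtain c e where "1 = u * c + e" "e \<in> I" by blast
    then show ?thesis by (metis add_diff_cancel_left')
  qed
  then show ?thesis using that one p(1) \<phi> unfolding maximal_pair_def by blast
qed

text \<open>A monic \<open>\<phi>\<close> of least positive degree with \<open>I\<close> inside
  \<open>(p, \<phi>)\<close> serves as an irreducible common factor modulo p; minimality replaces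
  factorisation and Zorn's lemma.\<close>

lemma exists_maximal_pair:
  assumes I: "poly_ideal I" and p: "prime (p :: int)" "[:p:] \<in> I" and one: "1 \<notin> I"
  obtains \<phi> where "maximal_pair p \<phi>" "I \<subseteq> ideal_pair p \<phi>"
proof -
  let ?Q = "\<lambda>v. lead_coeff v = 1 \<and> degree v > 0 \<and> I \<subseteq> ideal_pair p v"
  have "\<exists>v. ?Q v"
  proof (cases "\<exists>u\<in>I. \<not> [:p:] dvd u")
    case True
    then obtain v where "lead_coeff v = 1" "I = ideal_pair p v"
      using poly_ideal_mod_prime_principal[OF I p] by blast
    then show ?thesis using one one_in_ideal_pair_iff[OF p(1)] by blast
  next
    case False
    then have "I \<subseteq> ideal_pair p v" for v
      using poly_ideal_mult2[OF poly_ideal_pair p_in_ideal_pair] by (auto elim!: dvdE)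
    moreover have "lead_coeff [:0, 1 :: int:] = 1" "degree [:0, 1 :: int:] > 0" by simp_all
    ultimately show ?thesis by blast
  qed
  then obtain v0 where v0: "?Q v0" ..
  define \<phi> where "\<phi> = (ARG_MIN degree v. ?Q v)"
  have \<phi>: "?Q \<phi>" unfolding \<phi>_def using v0 by (rule arg_min_natI)
  have min: "degree \<phi> \<le> degree v" if "?Q v" for v
    unfolding \<phi>_def using that by (rule arg_min_nat_le)
  have "\<exists>c. 1 - u * c \<in> ideal_pair p \<phi>" if u: "u \<notin> ideal_pair p \<phi>" for u
  proof -
    obtain v where v: "lead_coeff v = 1" "{u * c + e | c e. e \<in> ideal_pair p \<phi>} = ideal_pair p v"
      "ideal_pair p \<phi> \<subseteq> ideal_pair p v" "u \<in> ideal_pair p v"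
      using ideal_pair_adjoin[OF p(1), of \<phi> u] \<phi> by blast
    \<comment> \<open>Otherwise minimality and \<open>\<phi>\<close> in \<open>(p, v)\<close> force
      equal degrees. Monic polynomials of equal degree with \<open>\<phi>\<close> in
      \<open>(p, v)\<close> agree modulo p, which would put \<open>u\<close> into
      \<open>(p, \<phi>)\<close>.\<close>
    have "degree v = 0"
    proof (rule ccontr)
      assume "degree v \<noteq> 0"
      then have le: "degree \<phi> \<le> degree v" using min[of v] v(1,3) \<phi> by blast
      have \<phi>v: "\<phi> \<in> ideal_pair p v" using v(3) phi_in_ideal_pair by blast
      have "\<not> degree \<phi> < degree v"
        using ideal_pair_small_degree[OF p(1) v(1) \<phi>v] not_prime_dvd_monic[OF p(1), of \<phi>] \<phi> by blast
      then have deg: "degree \<phi> = degree v" using le by simp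
      then have "coeff (\<phi> - v) (degree v) = 0" using \<phi> v(1) by simp
      moreover have "degree (\<phi> - v) \<le> degree v" using deg by (intro degree_diff_le) auto
      ultimately have "\<phi> - v = 0 \<or> degree (\<phi> - v) < degree v"
        by (metis leading_coeff_0_iff le_neq_implies_less)
      then have "[:p:] dvd \<phi> - v"
        using ideal_pair_small_degree[OF p(1) v(1)] poly_ideal_diff[OF poly_ideal_pair \<phi>v phi_in_ideal_pair] by blast
      then obtain d where "\<phi> - v = [:p:] * d" by (elim dvdE)
      then have "v = [:p:] * (- d) + \<phi> * 1" by (simp add: algebra_simps)
      then have "v \<in> ideal_pair p \<phi>" by (rule ideal_pairI)
      then have "ideal_pair p v \<subseteq> ideal_pair p \<phi>"
        by (intro ideal_pair_subset poly_ideal_pair p_in_ideal_pair)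
      then show False using v(4) u by blast
    qed
    then have "1 \<in> {u * c + e | c e. e \<in> ideal_pair p \<phi>}"
      unfolding v(2) using one_in_ideal_pair_iff[OF p(1) v(1)] by blast
    then obtain c e where "1 = u * c + e" "e \<in> ideal_pair p \<phi>" by blast
    then show ?thesis by (metis add_diff_cancel_left')
  qed
  then have "maximal_pair p \<phi>"
    using \<phi> p(1) one_in_ideal_pair_iff[OF p(1), of \<phi>] unfolding maximal_pair_def by auto
  then show ?thesis using \<phi> that by blast
qed

text \<open>The class of p in the cotangent space m/m^2 is nonzero: modulo p the relation reads
  \<open>\<phi>^2 a = 0\<close>, so p divides \<open>a\<close> and can be cancelled
  throughout.\<close>

lemma mult_p_in_ideal_pair_sq:
  assumes p: "prime (p :: int)" "lead_coeff \<phi> = 1" and u: "[:p:] * u \<in> ideal_pair_sq p \<phi>"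
  shows "u \<in> ideal_pair p \<phi>"
proof -
  obtain a b c where e: "[:p:] * u = \<phi> * \<phi> * a + [:p:] * \<phi> * b + [:p:] * [:p:] * c"
    using u by (elim ideal_pair_sqE)
  then have "\<phi> * (\<phi> * a) = [:p:] * (u - \<phi> * b - [:p:] * c)" by (simp add: algebra_simps)
  then have "[:p:] dvd \<phi> * (\<phi> * a)" by (metis dvd_triv_left)
  then have "[:p:] dvd a" by (rule dvd_of_dvd_mult_monic[OF p dvd_of_dvd_mult_monic[OF p]])
  then obtain a' where a': "a = [:p:] * a'" by (elim dvdE)
  have "[:p:] * u = [:p:] * ([:p:] * c + \<phi> * (\<phi> * a' + b))"
    unfolding e a' by (simp only: algebra_simps)
  moreover have "[:p:] \<noteq> 0" using p(1) by auto
  ultimately have "u = [:p:] * c + \<phi> * (\<phi> * a' + b)" by (simp only: mult_cancel_left simp_thms)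
  then show ?thesis by (rule ideal_pairI)
qed

lemma pderiv_ideal_pair_sq:
  assumes "u \<in> ideal_pair_sq p \<phi>" shows "pderiv u \<in> ideal_pair p \<phi>"
proof -
  obtain a b c where u: "u = \<phi> * \<phi> * a + [:p:] * \<phi> * b + [:p:] * [:p:] * c"
    using assms by (elim ideal_pair_sqE)
  have p: "pderiv [:p:] = 0" by (simp add: pderiv_pCons)
  show ?thesis
    by (rule ideal_pairI[of _ _ "pderiv \<phi> * b + [:p:] * pderiv c" _ "pderiv \<phi> * a + pderiv \<phi> * a + \<phi> * pderiv a + [:p:] * pderiv b"])
      (simp add: u pderiv_add pderiv_mult p algebra_simps)
qed

section \<open>Frobenius and the test polynomial\<close>

lemma subst_power_add: "subst_power (u + v) n = subst_power u n + subst_power v n"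
  and subst_power_diff: "subst_power (u - v) n = subst_power u n - subst_power v n"
  and subst_power_mult: "subst_power (u * v) n = subst_power u n * subst_power v n"
  and subst_power_const: "subst_power [:c:] n = [:c:]"
  and subst_power_0: "subst_power 0 n = 0"
  and subst_power_1: "subst_power 1 n = 1"
  and subst_power_pCons: "subst_power (pCons a u) n = [:a:] + monom 1 n * subst_power u n"
  unfolding subst_power_def
  by (simp_all add: pcompose_add pcompose_diff pcompose_mult pcompose_1 pcompose_pCons)

lemma subst_power_smult: "subst_power (smult c u) n = smult c (subst_power u n)"
  unfolding subst_power_def by (rule pcompose_smult)

lemma subst_power_power: "subst_power (u ^ i) n = subst_power u n ^ i"
  by (induction i) (simp_all add: subst_power_1 subst_power_mult)

lemma subst_power_monom: "subst_power (monom 1 d) n = monom 1 n ^ d"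
proof (induction d)
  case (Suc d)
  have "subst_power (monom 1 (Suc d)) n = monom 1 n * subst_power (monom 1 d) n"
    unfolding monom_Suc subst_power_pCons by simp
  then show ?case using Suc by simp
qed (simp add: subst_power_1)

lemma subst_power_subst_power: "subst_power (subst_power u m) n = subst_power u (m * n)"
proof (induction u)
  case (pCons a u)
  have "subst_power (monom 1 m) n = monom 1 (m * n)"
    unfolding subst_power_monom by (simp add: monom_power mult.commute)
  then show ?case using pCons
    by (simp add: subst_power_pCons subst_power_add subst_power_mult subst_power_const subst_power_0)
qed (simp add: subst_power_0)

lemma degree_subst_power: "degree (subst_power u n) = degree u * n"
  unfolding subst_power_def by (simp add: degree_pcompose degree_monom_eq)

lemma lead_coeff_subst_power:
  assumes "n > 0" shows "lead_coeff (subst_power u n) = lead_coeff u"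
  unfolding subst_power_def using assms by (subst lead_coeff_comp) (simp_all add: degree_monom_eq)

lemma coeff_subst_power:
  assumes "n > 0"
  shows "coeff (subst_power u n) i = (if n dvd i then coeff u (i div n) else 0)"
proof (induction u arbitrary: i)
  case (pCons a u)
  have "coeff (subst_power (pCons a u) n) i = coeff [:a:] i + (if i < n then 0 else coeff (subst_power u n) (i - n))"
    unfolding subst_power_pCons by (simp add: coeff_monom_mult)
  also have "\<dots> = (if n dvd i then coeff (pCons a u) (i div n) else 0)"
  proof (cases "i < n")
    case True
    then show ?thesis using assms by (cases "i = 0") (auto simp: coeff_pCons dvd_imp_le split: nat.splits)
  next
    case False
    then have "i div n = Suc ((i - n) div n)" "n dvd i \<longleftrightarrow> n dvd (i - n)" "i \<noteq> 0"
      using assms by (auto simp: le_div_geq dvd_minus_self)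
    then show ?thesis using False pCons.IH[of "i - n"] by (simp add: coeff_pCons split: nat.splits)
  qed
  finally show ?case .
qed (simp add: subst_power_0)

lemma poly_subst_power_0:
  assumes "n > 0" shows "poly (subst_power u n) 0 = poly u 0"
  using coeff_subst_power[OF assms, of u 0] by (simp add: poly_0_coeff_0)

text \<open>The middle binomial coefficients are divisible by p, and each middle term retains a
  factor \<open>a\<close> and a factor \<open>b\<close>. With \<open>b = - f\<close> the error is a
  multiple of p f, which falls into m^2 as soon as f lies in m.\<close>

lemma power_add_prime:
  fixes a b :: "'a :: comm_ring_1"
  assumes p: "prime p"
  obtains s where "(a + b) ^ p = a ^ p + b ^ p + of_nat p * (a * b * s)"
proof -
  define g where "g k = of_nat (p choose k) * a ^ k * b ^ (p - k)" for k
  define s where "s = (\<Sum>k\<in>{1..<p}. of_nat ((p choose k) div p) * a ^ (k - 1) * b ^ (p - k - 1))"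
  have p1: "p > 1" using p prime_gt_1_nat by blast
  have "{..p} = insert 0 (insert p {1..<p})" using p1 by auto
  then have "(a + b) ^ p = g 0 + (g p + (\<Sum>k\<in>{1..<p}. g k))"
    using p1 unfolding binomial_ring g_def by simp
  moreover have "g 0 = b ^ p" "g p = a ^ p" unfolding g_def by simp_all
  moreover have "(\<Sum>k\<in>{1..<p}. g k) = of_nat p * (a * b * s)"
    unfolding s_def sum_distrib_left
  proof (rule sum.cong)
    fix k assume k: "k \<in> {1..<p}"
    then have "p dvd (p choose k)" using p by (intro dvd_choose_prime) auto
    then have "of_nat (p choose k) = (of_nat p * of_nat ((p choose k) div p) :: 'a)"
      by (metis dvd_mult_div_cancel of_nat_mult)
    moreover have "a ^ k = a * a ^ (k - 1)" "b ^ (p - k) = b * b ^ (p - k - 1)"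
      using k by (simp_all add: power_eq_if)
    ultimately show "g k = of_nat p * (a * b * (of_nat ((p choose k) div p) * a ^ (k - 1) * b ^ (p - k - 1)))"
      unfolding g_def by (simp only: ac_simps)
  qed simp
  ultimately show ?thesis by (intro that[of s]) (simp add: ac_simps)
qed

lemma fermat_int:
  assumes p: "prime p" shows "int p dvd a ^ p - a"
proof (induction a rule: int_induct[where k = 0])
  case base
  then show ?case using p prime_gt_0_nat[OF p] by (simp add: power_0_left)
next
  case (step1 i)
  obtain s where s: "(i + 1) ^ p = i ^ p + 1 ^ p + of_nat p * (i * 1 * s)" using power_add_prime[OF p] .
  have "(i + 1) ^ p - (i + 1) = (i ^ p - i) + int p * (i * s)" unfolding s by (simp only: algebra_simps power_one mult_1_right)
  then show ?case using step1 by (simp only: dvd_add_left_iff dvd_triv_left)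
next
  case (step2 i)
  obtain s where s: "((i - 1) + 1) ^ p = (i - 1) ^ p + 1 ^ p + of_nat p * ((i - 1) * 1 * s)"
    using power_add_prime[OF p] .
  have "(i - 1) ^ p - (i - 1) = (i ^ p - i) - int p * ((i - 1) * s)" using s by simp
  then show ?case using step2 by (simp only: dvd_diff dvd_triv_left)
qed

text \<open>Substituting x^p lifts the Frobenius of F_p[x]: Fermat handles each coefficient and the
  binomial expansion handles sums.\<close>

lemma subst_power_prime:
  assumes p: "prime p"
  obtains t where "subst_power u p = u ^ p + [:int p:] * t"
proof -
  have "\<exists>t. subst_power u p = u ^ p + [:int p:] * t"
  proof (induction u)
    case 0
    then show ?case using prime_gt_0_nat[OF p] by (intro exI[of _ 0]) (simp add: subst_power_0 power_0_left)
  next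
    case (pCons a u)
    then obtain t where t: "subst_power u p = u ^ p + [:int p:] * t" by blast
    obtain c where c: "a ^ p - a = int p * c" using fermat_int[OF p, of a] by (elim dvdE)
    obtain s where s: "([:a:] + monom 1 1 * u) ^ p =
        [:a:] ^ p + (monom 1 1 * u) ^ p + of_nat p * ([:a:] * (monom 1 1 * u) * s)"
      using power_add_prime[OF p] .
    have "[:a:] ^ p = [:a ^ p:]" by (rule poly_const_pow)
    also have "\<dots> = [:a:] + [:int p:] * [:c:]" using c by (simp add: mult_pCons_left)
    finally have a: "[:a:] ^ p = [:a:] + [:int p:] * [:c:]" .
    have x: "(monom 1 1 * u) ^ p = monom 1 p * u ^ p" by (simp add: power_mult_distrib monom_power)
    have u: "pCons a u = [:a:] + monom 1 1 * u"
      by (simp add: monom_Suc mult_pCons_left)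
    have n: "(of_nat p :: int poly) = [:int p:]" by (rule of_nat_poly)
    have "pCons a u ^ p = [:a:] + [:int p:] * [:c:] + monom 1 p * u ^ p
        + [:int p:] * ([:a:] * (monom 1 1 * u) * s)"
      unfolding u s a x n ..
    moreover have "subst_power (pCons a u) p = [:a:] + monom 1 p * (u ^ p + [:int p:] * t)"
      unfolding subst_power_pCons t ..
    ultimately have "subst_power (pCons a u) p = pCons a u ^ p
        + [:int p:] * (monom 1 p * t - [:c:] - [:a:] * (monom 1 1 * u) * s)"
      by (simp only: algebra_simps)
    then show ?case by blast
  qed
  then show ?thesis using that by blast
qed

text \<open>Since -A h = x^d - f, its p-th power is x^(dp) + (-f)^p up to a multiple of p f, and the
  monomial cancels against A h(x^p) = f(x^p) - x^(dp).\<close>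

lemma test_numerator_decomp:
  assumes p: "prime p" and f: "f = monom 1 d + smult A h"
  obtains s where "test_numerator A h p = subst_power f p - f ^ p + [:int p:] * (f * s)"
proof -
  let ?x = "monom (1 :: int) d"
  have n: "(of_nat p :: int poly) = [:int p:]" by (rule of_nat_poly)
  obtain s where s: "(?x + (- f)) ^ p = ?x ^ p + (- f) ^ p + of_nat p * (?x * (- f) * s)"
    using power_add_prime[OF p] .
  \<comment> \<open>For odd p the sign passes through the power. For p = 2, (-f)^2 and -(f^2) differ
    by 2 f^2, which is again a multiple of p f.\<close>
  obtain t where t: "(- f) ^ p = - (f ^ p) + [:int p:] * (f * t)"
  proof (cases "p = 2")
    case True
    have "(- f) ^ p = - (f ^ p) + [:int p:] * (f * f)"
      using True by (simp add: mult_pCons_left power2_eq_square numeral_mult_conv_smult)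
    then show ?thesis by (rule that)
  next
    case False
    then have "odd p" using p prime_odd_nat prime_gt_1_nat[OF p] by auto
    then show ?thesis by (intro that[of 0]) simp
  qed
  have "?x + (- f) = - smult A h" using f by simp
  then have 1: "(- smult A h) ^ p = ?x ^ p + (- f) ^ p + of_nat p * (?x * (- f) * s)" using s by simp
  have "smult A (subst_power h p) = subst_power (f - ?x) p" using f by (simp add: subst_power_smult)
  also have "\<dots> = subst_power f p - ?x ^ p"
    unfolding subst_power_diff subst_power_monom by (simp add: monom_power mult.commute)
  finally have "test_numerator A h p = subst_power f p - f ^ p + [:int p:] * (f * (t - ?x * s))"
    unfolding test_numerator_def 1 t n by (simp add: algebra_simps)
  then show ?thesis by (rule that)
qed

lemma prime_dvd_test_numerator:
  assumes "prime p" "f = monom 1 d + smult A h"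
  shows "[:int p:] dvd test_numerator A h p"
proof -
  obtain s where "test_numerator A h p = subst_power f p - f ^ p + [:int p:] * (f * s)"
    using test_numerator_decomp[OF assms] .
  moreover obtain t where "subst_power f p = f ^ p + [:int p:] * t" using subst_power_prime[OF assms(1)] .
  ultimately have "test_numerator A h p = [:int p:] * (t + f * s)" by (simp add: algebra_simps)
  then show ?thesis by (metis dvd_triv_left)
qed

lemma test_poly_eq:
  assumes "prime p" "f = monom 1 d + smult A h"
  shows "test_numerator A h p = [:int p:] * test_poly A h p"
proof -
  have "int p dvd coeff (test_numerator A h p) i" for i
    using prime_dvd_test_numerator[OF assms] by (simp add: const_poly_dvd_iff)
  then show ?thesis unfolding test_poly_def
    by (intro poly_eqI) (simp add: mult_pCons_left coeff_map_poly)
qed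

text \<open>Finite fields are perfect. If the derivative vanishes modulo p, then
  \<open>\<phi>\<close> is \<psi>(x^p), hence \<open>\<psi> ^ p\<close>, modulo p. So
  \<open>\<psi>\<close> lies in \<open>(p, \<phi>)\<close> with smaller degree and vanishes modulo
  p, and with it the monic \<open>\<phi>\<close>.\<close>

lemma maximal_pair_separable:
  assumes m: "maximal_pair (int p) \<phi>"
  shows "pderiv \<phi> \<notin> ideal_pair (int p) \<phi>"
proof
  assume d: "pderiv \<phi> \<in> ideal_pair (int p) \<phi>"
  note M = maximal_pairD[OF m]
  have p: "prime p" using M(1) by simp
  have p1: "p > 1" using prime_gt_1_nat[OF p] .
  have "degree (pderiv \<phi>) < degree \<phi>" using M(4) by (simp add: degree_pderiv)
  then have "[:int p:] dvd pderiv \<phi>" using ideal_pair_small_degree[OF M(1,2) d] by blast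
  then have c: "int p dvd of_nat (Suc i) * coeff \<phi> (Suc i)" for i
    by (simp add: const_poly_dvd_iff coeff_pderiv)
  have c: "int p dvd coeff \<phi> i" if "\<not> p dvd i" for i
  proof -
    obtain j where j: "i = Suc j" using \<open>\<not> p dvd i\<close> by (cases i) auto
    have "\<not> int p dvd int i" using that by simp
    then show ?thesis using c[of j] M(1) unfolding j by (simp only: prime_dvd_mult_iff simp_thms)
  qed
  \<comment> \<open>The p-th root of \<open>\<phi>\<close> modulo p: elements of F_p are their own
    p-th powers, so its coefficients are simply picked out of \<open>\<phi>\<close>.\<close>
  define \<psi> where "\<psi> = (\<Sum>j\<le>degree \<phi>. monom (coeff \<phi> (p * j)) j)"
  have co: "coeff \<psi> j = coeff \<phi> (p * j)" for j
  proof (cases "j \<le> degree \<phi>")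
    case False
    then have "degree \<phi> < p * j" using p1 by (smt (verit) le_eq_less_or_eq mult_le_mono1 nat_mult_1 not_le order_trans)
    then show ?thesis using False unfolding \<psi>_def by (simp add: coeff_sum coeff_eq_0)
  qed (simp add: \<psi>_def coeff_sum)
  have "degree \<psi> \<le> degree \<phi> div p"
  proof (rule degree_le, intro allI impI)
    fix i assume "degree \<phi> div p < i"
    then have "degree \<phi> < p * i" using p1 by (simp add: div_less_iff_less_mult mult.commute)
    then show "coeff \<psi> i = 0" unfolding co by (rule coeff_eq_0)
  qed
  also have "degree \<phi> div p < degree \<phi>" using p1 M(4) by simp
  finally have deg: "degree \<psi> < degree \<phi>" .
  have "[:int p:] dvd \<phi> - subst_power \<psi> p"
    unfolding const_poly_dvd_iff
  proof
    fix i show "int p dvd coeff (\<phi> - subst_power \<psi> p) i"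
      using c[of i] p1 by (cases "p dvd i") (simp_all add: coeff_subst_power co)
  qed
  then obtain r where r: "\<phi> - subst_power \<psi> p = [:int p:] * r" by (elim dvdE)
  obtain t where t: "subst_power \<psi> p = \<psi> ^ p + [:int p:] * t" using subst_power_prime[OF p] .
  have "\<psi> ^ p = [:int p:] * (- r - t) + \<phi> * 1" using r t by (simp add: algebra_simps)
  then have "\<psi> ^ p \<in> ideal_pair (int p) \<phi>" by (rule ideal_pairI)
  then have "[:int p:] dvd \<psi>"
    using maximal_pair_power[OF m] ideal_pair_small_degree[OF M(1,2)] deg by blast
  then have "int p dvd coeff \<phi> i" for i
    using c[of i] co[of "i div p"] unfolding const_poly_dvd_iff by (cases "p dvd i") (metis dvd_mult_div_cancel)+
  then show False using not_prime_dvd_monic[OF M(1,2)] by (simp add: const_poly_dvd_iff)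
qed

section \<open>Singular primes under \<open>x \<mapsto> x^k\<close>\<close>

text \<open>Geometrically: \<open>Spec (\<int>[x]/(g))\<close> has a non-regular point above \<open>p\<close>.\<close>

definition singular_mod :: "nat \<Rightarrow> int poly \<Rightarrow> bool" where
  "singular_mod p g \<longleftrightarrow> (\<exists>\<phi>. maximal_pair (int p) \<phi> \<and> g \<in> ideal_pair_sq (int p) \<phi>)"

lemma dvdm_iff_ideal_pair: "poly_mod.dvdm p r u \<longleftrightarrow> u \<in> ideal_pair p r"
proof -
  have "poly_mod.Mp p u = poly_mod.Mp p (r * c) \<longleftrightarrow> [:p:] dvd u - r * c" for c
    by (simp add: poly_eq_iff poly_mod.Mp_coeff poly_mod.M_def const_poly_dvd_iff mod_eq_dvd_iff)
  also have "[:p:] dvd u - r * c \<longleftrightarrow> (\<exists>a. u = [:p:] * a + r * c)" for c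
    by (auto simp: dvd_def diff_eq_eq)
  finally show ?thesis unfolding poly_mod.dvdm_def ideal_pair_def by blast
qed

text \<open>A common divisor \<open>r\<close> modulo p that is not a unit generates, with p, a
  proper ideal. As \<open>r\<close> may vanish modulo p, \<open>exists_maximal_pair\<close> also
  covers ideals that are zero modulo p.\<close>

lemma coprime_m_iff_maximal_pair:
  assumes p: "prime p"
  shows "poly_mod.coprime_m (int p) u v \<longleftrightarrow>
    \<not> (\<exists>\<phi>. maximal_pair (int p) \<phi> \<and> u \<in> ideal_pair (int p) \<phi> \<and> v \<in> ideal_pair (int p) \<phi>)"
proof
  assume "poly_mod.coprime_m (int p) u v"
  then show "\<not> (\<exists>\<phi>. maximal_pair (int p) \<phi> \<and> u \<in> ideal_pair (int p) \<phi> \<and> v \<in> ideal_pair (int p) \<phi>)"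
    unfolding poly_mod.coprime_m_def dvdm_iff_ideal_pair using maximal_pairD(3) by blast
next
  assume *: "\<not> (\<exists>\<phi>. maximal_pair (int p) \<phi> \<and> u \<in> ideal_pair (int p) \<phi> \<and> v \<in> ideal_pair (int p) \<phi>)"
  have "1 \<in> ideal_pair (int p) r" if "u \<in> ideal_pair (int p) r" "v \<in> ideal_pair (int p) r" for r
  proof (rule ccontr)
    assume "1 \<notin> ideal_pair (int p) r"
    moreover have "prime (int p)" using p by simp
    ultimately obtain \<phi> where "maximal_pair (int p) \<phi>" "ideal_pair (int p) r \<subseteq> ideal_pair (int p) \<phi>"
      using exists_maximal_pair[OF poly_ideal_pair _ p_in_ideal_pair, of "int p" r thesis] by blast
    then show False using * that by blast
  qed
  then show "poly_mod.coprime_m (int p) u v"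
    unfolding poly_mod.coprime_m_def dvdm_iff_ideal_pair by blast
qed

section \<open>Transport of ideals along x -> x^n\<close>

lemma poly_ideal_contraction:
  assumes "poly_ideal I" shows "poly_ideal {u. subst_power u n \<in> I}"
  using assms unfolding poly_ideal_def by (auto simp: subst_power_0 subst_power_add subst_power_mult)

text \<open>Lying over: \<phi>(x^n) is monic of positive degree, so together with p it still
  generates a proper ideal.\<close>

lemma maximal_pair_above:
  assumes m: "maximal_pair p \<phi>" and n: "n > 0"
  obtains \<psi> where "maximal_pair p \<psi>" "subst_power \<phi> n \<in> ideal_pair p \<psi>"
proof -
  note M = maximal_pairD[OF m]
  have "lead_coeff (subst_power \<phi> n) = 1" using M(2) lead_coeff_subst_power[OF n] by simp
  then have "1 \<notin> ideal_pair p (subst_power \<phi> n)"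
    using one_in_ideal_pair_iff[OF M(1)] M(4) n by (simp add: degree_subst_power)
  then obtain \<psi> where "maximal_pair p \<psi>" "ideal_pair p (subst_power \<phi> n) \<subseteq> ideal_pair p \<psi>"
    by (rule exists_maximal_pair[OF poly_ideal_pair M(1) p_in_ideal_pair])
  then show ?thesis using that phi_in_ideal_pair by blast
qed

lemma subst_power_ideal_pair:
  assumes "u \<in> ideal_pair p \<phi>" "subst_power \<phi> n \<in> ideal_pair p \<psi>"
  shows "subst_power u n \<in> ideal_pair p \<psi>"
proof -
  have "ideal_pair p \<phi> \<subseteq> {u. subst_power u n \<in> ideal_pair p \<psi>}"
    using assms(2) p_in_ideal_pair[of p \<psi>]
    by (intro ideal_pair_subset poly_ideal_contraction poly_ideal_pair) (simp_all add: subst_power_const)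
  then show ?thesis using assms(1) by blast
qed

lemma subst_power_ideal_pair_sq:
  assumes "u \<in> ideal_pair_sq p \<phi>" "subst_power \<phi> n \<in> ideal_pair p \<psi>"
  shows "subst_power u n \<in> ideal_pair_sq p \<psi>"
proof -
  obtain a b c where u: "u = \<phi> * \<phi> * a + [:p:] * \<phi> * b + [:p:] * [:p:] * c"
    using assms by (elim ideal_pair_sqE)
  note I = poly_ideal_pair_sq[of p \<psi>]
  show ?thesis
    unfolding u subst_power_add subst_power_mult subst_power_const
    by (intro poly_ideal_add[OF I] poly_ideal_mult2[OF I] mult_in_ideal_pair_sq assms(2) p_in_ideal_pair)
qed

lemma singular_mod_subst_power:
  assumes "singular_mod p f" "n > 0" shows "singular_mod p (subst_power f n)"
  using assms maximal_pair_above subst_power_ideal_pair_sq unfolding singular_mod_def by metis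

lemma singular_mod_subst_power_dvd:
  assumes p: "prime p" "p dvd k" and k: "k > 0" and f: "f = monom 1 d + smult A h"
  shows "singular_mod p (subst_power f k) \<longleftrightarrow> \<not> poly_mod.coprime_m (int p) (test_poly A h p) f"
proof -
  obtain n where n: "k = p * n" using p(2) by (elim dvdE)
  have n0: "n > 0" using n k by simp
  have p': "prime (int p)" using p(1) by simp
  obtain s where s: "test_numerator A h p = subst_power f p - f ^ p + [:int p:] * (f * s)"
    using test_numerator_decomp[OF p(1) f] .
  define t where "t = test_poly A h p"
  have "subst_power f p = [:int p:] * t + f ^ p - [:int p:] * (f * s)"
    using s unfolding t_def test_poly_eq[OF p(1) f] by (simp add: algebra_simps)
  then have F: "subst_power f k = [:int p:] * subst_power t n + subst_power f n ^ p
      - [:int p:] * (subst_power f n * subst_power s n)"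
    unfolding n subst_power_subst_power[symmetric]
    by (simp add: subst_power_add subst_power_diff subst_power_mult subst_power_const subst_power_power)
  have key: "subst_power f k \<in> ideal_pair_sq (int p) \<psi> \<longleftrightarrow>
      subst_power f n \<in> ideal_pair (int p) \<psi> \<and> subst_power t n \<in> ideal_pair (int p) \<psi>"
    if m: "maximal_pair (int p) \<psi>" for \<psi>
  proof -
    note M = maximal_pairD[OF m]
    note I = poly_ideal_pair[of "int p" \<psi>] and J = poly_ideal_pair_sq[of "int p" \<psi>]
    have "p = Suc (Suc (p - 2))" using prime_ge_2_nat[OF p(1)] by simp
    then have pow: "subst_power f n ^ p = subst_power f n * subst_power f n * subst_power f n ^ (p - 2)"
      by (metis mult.assoc power_Suc)
    have fn: "subst_power f n \<in> ideal_pair (int p) \<psi>" if "subst_power f k \<in> ideal_pair_sq (int p) \<psi>"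
    proof -
      have "subst_power f n ^ p = subst_power f k
          - [:int p:] * (subst_power t n - subst_power f n * subst_power s n)"
        unfolding F by (simp add: algebra_simps)
      also have "\<dots> \<in> ideal_pair (int p) \<psi>"
        using that ideal_pair_sq_subset_pair
        by (intro poly_ideal_diff[OF I] poly_ideal_mult2[OF I] p_in_ideal_pair) blast
      finally show ?thesis by (rule maximal_pair_power[OF m])
    qed
    have "subst_power f k \<in> ideal_pair_sq (int p) \<psi> \<longleftrightarrow> subst_power t n \<in> ideal_pair (int p) \<psi>"
      if fn: "subst_power f n \<in> ideal_pair (int p) \<psi>"
    proof -
      define r where "r = subst_power f n ^ p - [:int p:] * (subst_power f n * subst_power s n)"
      have "r = subst_power f n * subst_power f n * subst_power f n ^ (p - 2)
          - [:int p:] * subst_power f n * subst_power s n"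
        unfolding r_def pow by (simp only: mult.assoc)
      also have "\<dots> \<in> ideal_pair_sq (int p) \<psi>"
        by (intro poly_ideal_diff[OF J] poly_ideal_mult2[OF J] mult_in_ideal_pair_sq fn p_in_ideal_pair)
      finally have r: "r \<in> ideal_pair_sq (int p) \<psi>" .
      have F: "subst_power f k = [:int p:] * subst_power t n + r" unfolding F r_def by simp
      show ?thesis
      proof
        assume "subst_power f k \<in> ideal_pair_sq (int p) \<psi>"
        then have "[:int p:] * subst_power t n \<in> ideal_pair_sq (int p) \<psi>"
          using poly_ideal_diff[OF J _ r, of "subst_power f k"] unfolding F by simp
        then show "subst_power t n \<in> ideal_pair (int p) \<psi>"
          by (rule mult_p_in_ideal_pair_sq[OF M(1,2)])
      next
        assume "subst_power t n \<in> ideal_pair (int p) \<psi>"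
        then show "subst_power f k \<in> ideal_pair_sq (int p) \<psi>"
          unfolding F by (intro poly_ideal_add[OF J] r mult_in_ideal_pair_sq p_in_ideal_pair)
      qed
    qed
    then show ?thesis using fn by blast
  qed
  show ?thesis
  proof
    assume "singular_mod p (subst_power f k)"
    then obtain \<psi> where m: "maximal_pair (int p) \<psi>" and F: "subst_power f k \<in> ideal_pair_sq (int p) \<psi>"
      unfolding singular_mod_def by blast
    \<comment> \<open>Both \<open>f\<close> and \<open>t\<close> lie in the contraction of
      \<open>(p, \<psi>)\<close> along x -> x^n, so any maximal ideal containing it is a common
      factor modulo p.\<close>
    let ?I = "{u. subst_power u n \<in> ideal_pair (int p) \<psi>}"
    have "poly_ideal ?I" "[:int p:] \<in> ?I" "1 \<notin> ?I"
      using maximal_pairD(3)[OF m]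
      by (simp_all add: poly_ideal_contraction poly_ideal_pair subst_power_const subst_power_1 p_in_ideal_pair)
    then obtain \<phi> where "maximal_pair (int p) \<phi>" "?I \<subseteq> ideal_pair (int p) \<phi>"
      by (rule exists_maximal_pair[OF _ p'])
    then show "\<not> poly_mod.coprime_m (int p) (test_poly A h p) f"
      unfolding coprime_m_iff_maximal_pair[OF p(1)] using F key[OF m] t_def by blast
  next
    assume "\<not> poly_mod.coprime_m (int p) (test_poly A h p) f"
    then obtain \<phi> where m: "maximal_pair (int p) \<phi>" and "t \<in> ideal_pair (int p) \<phi>" "f \<in> ideal_pair (int p) \<phi>"
      unfolding coprime_m_iff_maximal_pair[OF p(1)] t_def by blast
    moreover obtain \<psi> where "maximal_pair (int p) \<psi>" "subst_power \<phi> n \<in> ideal_pair (int p) \<psi>"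
      using maximal_pair_above[OF m n0] .
    ultimately show "singular_mod p (subst_power f k)"
      unfolding singular_mod_def using key subst_power_ideal_pair by metis
  qed
qed

text \<open>With x in m, reduction modulo m is evaluation at 0 modulo p, so elements of m^2 take
  values at 0 divisible by p^2. For f(x^k) this value is \<open>A * poly h 0\<close>; and d > 1 puts
  x^d into m^2.\<close>

lemma singular_mod_subst_power_at_0:
  assumes m: "maximal_pair p \<phi>" and x: "[:0, 1:] \<in> ideal_pair p \<phi>"
    and f: "f = monom 1 d + smult A h" and d: "d > 1" and h: "\<bar>poly h 0\<bar> = 1"
    and k: "k > 0" and F: "subst_power f k \<in> ideal_pair_sq p \<phi>"
  shows "f \<in> ideal_pair_sq p \<phi>"
proof -
  note M = maximal_pairD[OF m]
  have ev: "p dvd poly u 0" if u: "u \<in> ideal_pair p \<phi>" for u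
  proof -
    obtain c v where cv: "u = pCons c v" by (cases u) auto
    \<comment> \<open>The constant term differs from \<open>u\<close> by a multiple of x, so it is
      an element of m of degree 0, hence divisible by p.\<close>
    have "[:c:] = u - [:0, 1:] * v" unfolding cv by (simp add: mult_pCons_left)
    also have "\<dots> \<in> ideal_pair p \<phi>"
      by (intro poly_ideal_diff[OF poly_ideal_pair] poly_ideal_mult2[OF poly_ideal_pair] u x)
    finally have "[:p:] dvd [:c:]" using M(4) by (intro ideal_pair_small_degree[OF M(1,2)]) auto
    then show ?thesis unfolding cv by (simp add: const_poly_dvd_const_poly_iff)
  qed
  obtain a b c where "subst_power f k = \<phi> * \<phi> * a + [:p:] * \<phi> * b + [:p:] * [:p:] * c"
    using F by (elim ideal_pair_sqE)
  moreover obtain e where "poly \<phi> 0 = p * e" using ev[OF phi_in_ideal_pair] by (elim dvdE)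
  ultimately have "poly (subst_power f k) 0 = p * p * (e * e * poly a 0 + e * poly b 0 + poly c 0)"
    by (simp add: algebra_simps)
  moreover have "poly (subst_power f k) 0 = A * poly h 0"
    using d unfolding poly_subst_power_0[OF k] f by (simp add: poly_monom)
  ultimately have "p * p dvd A * poly h 0" by simp
  moreover have "is_unit (poly h 0)" using h by auto
  ultimately obtain B where B: "A = p * p * B" using dvd_mult_unit_iff by (metis dvdE)
  have "monom 1 d = [:0, 1:] * [:0, 1:] * monom (1 :: int) (d - 2)"
    using d by (simp add: mult_pCons_left monom_Suc[symmetric] Suc_diff_Suc numeral_2_eq_2)
  moreover have "smult A h = [:p:] * [:p:] * smult B h" unfolding B by (simp add: mult_pCons_left mult.commute[of B])
  ultimately have "f = [:0, 1:] * [:0, 1:] * monom 1 (d - 2) + [:p:] * [:p:] * smult B h"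
    using f by (simp only:)
  also have "\<dots> \<in> ideal_pair_sq p \<phi>"
    by (intro poly_ideal_add[OF poly_ideal_pair_sq] poly_ideal_mult2[OF poly_ideal_pair_sq]
        mult_in_ideal_pair_sq x p_in_ideal_pair)
  finally show ?thesis .
qed

text \<open>Away from \<open>0\<close> and for \<open>p\<close> not dividing \<open>k\<close>, the map \<open>x \<mapsto> x^k\<close> is etale; the
  derivative test replaces the local ring argument.\<close>

lemma singular_mod_subst_power_etale:
  assumes m: "maximal_pair (int p) \<psi>" and x: "[:0, 1:] \<notin> ideal_pair (int p) \<psi>"
    and pk: "\<not> p dvd k" and f: "lead_coeff f = 1" and F: "subst_power f k \<in> ideal_pair_sq (int p) \<psi>"
  shows "singular_mod p f"
proof -
  note M = maximal_pairD[OF m]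
  note J = poly_ideal_pair[of "int p" \<psi>]
  have k: "k > 0" using pk by (cases k) auto
  let ?I = "{u. subst_power u k \<in> ideal_pair (int p) \<psi>}"
  have I: "poly_ideal ?I" by (intro poly_ideal_contraction poly_ideal_pair)
  have fI: "f \<in> ?I" using F ideal_pair_sq_subset_pair by blast
  \<comment> \<open>The contraction of a maximal ideal is prime; it contains p and the monic
    \<open>f\<close>, so it is maximal.\<close>
  obtain \<phi> where \<phi>: "maximal_pair (int p) \<phi>" "?I = ideal_pair (int p) \<phi>"
  proof (rule prime_ideal_maximal_pair[OF I M(1) _ _ _ fI f])
    show "[:int p:] \<in> ?I" "1 \<notin> ?I" using M(3) by (simp_all add: subst_power_const subst_power_1 p_in_ideal_pair)
    show "u \<in> ?I \<or> v \<in> ?I" if "u * v \<in> ?I" for u v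
      using that maximal_pair_prime[OF m] by (auto simp: subst_power_mult)
  qed
  \<comment> \<open>Chain rule: the derivative of u(x^k) is u'(x^k) k x^(k-1), and both k and x are
    invertible modulo \<open>(p, \<psi>)\<close>.\<close>
  have deriv: "u' \<in> ?I" if "subst_power u k \<in> ideal_pair_sq (int p) \<psi>" "u' = pderiv u" for u u'
  proof -
    have "monom (int k) (k - 1) = [:int k:] * [:0, 1:] ^ (k - 1)"
      by (simp add: mult_pCons_left monom_altdef)
    then have "pderiv (subst_power u k) = subst_power u' k * ([:int k:] * [:0, 1:] ^ (k - 1))"
      unfolding subst_power_def pderiv_pcompose that(2)
      by (simp add: pderiv_monom)
    then have "([:int k:] * [:0, 1:] ^ (k - 1)) * subst_power u' k \<in> ideal_pair (int p) \<psi>"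
      using pderiv_ideal_pair_sq[OF that(1)] by (simp only: mult.commute)
    moreover have "[:int k:] \<notin> ideal_pair (int p) \<psi>"
    proof
      assume "[:int k:] \<in> ideal_pair (int p) \<psi>"
      then have "[:int p:] dvd [:int k:]" using M(4) by (intro ideal_pair_small_degree[OF M(1,2)]) auto
      then show False using pk by (simp add: const_poly_dvd_const_poly_iff)
    qed
    moreover have "[:0, 1:] ^ (k - 1) \<notin> ideal_pair (int p) \<psi>" using x maximal_pair_power[OF m] by blast
    ultimately show ?thesis using maximal_pair_prime[OF m] by blast
  qed
  \<comment> \<open>Differentiating \<open>f\<close> leaves \<open>pderiv \<phi> * u\<close> modulo
    the contraction. Separability makes \<open>pderiv \<phi>\<close> invertible there, so
    \<open>u\<close> lies in it and \<open>f\<close> is \<open>\<phi>^2 u1 + p v'\<close>.\<close>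
  obtain v u where fuv: "f = [:int p:] * v + \<phi> * u" using fI unfolding \<phi>(2) by (elim ideal_pairE)
  have \<phi>I: "\<phi> \<in> ?I" and pI: "[:int p:] \<in> ?I" unfolding \<phi>(2) by (rule phi_in_ideal_pair p_in_ideal_pair)+
  have "pderiv f = [:int p:] * pderiv v + \<phi> * pderiv u + pderiv \<phi> * u"
    unfolding fuv by (simp add: pderiv_add pderiv_mult pderiv_pCons algebra_simps)
  then have "pderiv \<phi> * u = pderiv f - ([:int p:] * pderiv v + \<phi> * pderiv u)" by simp
  also have "\<dots> \<in> ?I"
    by (intro poly_ideal_diff[OF I] poly_ideal_add[OF I] poly_ideal_mult2[OF I] deriv[OF F refl] \<phi>I pI)
  finally have "u \<in> ideal_pair (int p) \<phi>"
    unfolding \<phi>(2) using maximal_pair_prime[OF \<phi>(1)] maximal_pair_separable[OF \<phi>(1)] by blast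
  then obtain u2 u1 where u: "u = [:int p:] * u2 + \<phi> * u1" by (elim ideal_pairE)
  define v' where "v' = v + \<phi> * u2"
  have f': "f = \<phi> * \<phi> * u1 + [:int p:] * v'" unfolding fuv u v'_def by (simp add: algebra_simps)
  \<comment> \<open>It remains to place \<open>v'\<close> in the contraction: after substitution the
    square term lies in the square ideal, so p v'(x^k) does too, and p cancels.\<close>
  have "[:int p:] * subst_power v' k
      = subst_power f k - subst_power \<phi> k * subst_power \<phi> k * subst_power u1 k"
    unfolding f' by (simp add: subst_power_add subst_power_mult subst_power_const)
  also have "\<dots> \<in> ideal_pair_sq (int p) \<psi>"
    using \<phi>I F
    by (intro poly_ideal_diff[OF poly_ideal_pair_sq] poly_ideal_mult2[OF poly_ideal_pair_sq] mult_in_ideal_pair_sq)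
      simp_all
  finally have "v' \<in> ?I" using mult_p_in_ideal_pair_sq[OF M(1,2)] by simp
  then have "v' \<in> ideal_pair (int p) \<phi>" unfolding \<phi>(2) .
  then have "f \<in> ideal_pair_sq (int p) \<phi>" unfolding f'
    by (intro poly_ideal_add[OF poly_ideal_pair_sq] poly_ideal_mult2[OF poly_ideal_pair_sq]
        mult_in_ideal_pair_sq phi_in_ideal_pair p_in_ideal_pair)
  then show ?thesis unfolding singular_mod_def using \<phi>(1) by blast
qed

lemma singular_mod_subst_power_not_dvd:
  assumes "f = monom 1 d + smult A h" "d > 1" "\<bar>poly h 0\<bar> = 1" "lead_coeff f = 1" "k > 0" "\<not> p dvd k"
    and "singular_mod p (subst_power f k)"
  shows "singular_mod p f"
proof -
  obtain \<psi> where m: "maximal_pair (int p) \<psi>" and F: "subst_power f k \<in> ideal_pair_sq (int p) \<psi>"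
    using assms(7) unfolding singular_mod_def by blast
  show ?thesis
  proof (cases "[:0, 1:] \<in> ideal_pair (int p) \<psi>")
    case True
    then show ?thesis
      using singular_mod_subst_power_at_0[OF m True assms(1-3,5) F] m unfolding singular_mod_def by blast
  next
    case False
    then show ?thesis using singular_mod_subst_power_etale[OF m False assms(6,4) F] by blast
  qed
qed

section \<open>Dedekind's criterion\<close>

interpretation of_rat_poly_hom: map_poly_comm_ring_hom "of_rat :: rat \<Rightarrow> complex" ..

definition eval_at :: "complex \<Rightarrow> int poly \<Rightarrow> complex" where
  "eval_at \<theta> u = poly (map_poly of_int u) \<theta>"

lemma eval_at_add: "eval_at \<theta> (u + v) = eval_at \<theta> u + eval_at \<theta> v"
  and eval_at_diff: "eval_at \<theta> (u - v) = eval_at \<theta> u - eval_at \<theta> v"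
  and eval_at_mult: "eval_at \<theta> (u * v) = eval_at \<theta> u * eval_at \<theta> v"
  and eval_at_power: "eval_at \<theta> (u ^ n) = eval_at \<theta> u ^ n"
  and eval_at_const: "eval_at \<theta> [:c:] = of_int c"
  and eval_at_0: "eval_at \<theta> 0 = 0"
  and eval_at_1: "eval_at \<theta> 1 = 1"
  and eval_at_sum: "eval_at \<theta> (sum F S) = (\<Sum>i\<in>S. eval_at \<theta> (F i))"
  unfolding eval_at_def by (simp_all add: hom_distribs poly_sum)

lemma eval_at_altdef:
  assumes "degree u < n"
  shows "eval_at \<theta> u = (\<Sum>i<n. of_int (coeff u i) * \<theta> ^ i)"
proof -
  have "eval_at \<theta> u = (\<Sum>i\<le>degree u. of_int (coeff u i) * \<theta> ^ i)"
    unfolding eval_at_def by (simp add: poly_altdef)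
  also have "\<dots> = (\<Sum>i<n. of_int (coeff u i) * \<theta> ^ i)"
    using assms by (intro sum.mono_neutral_left) (auto simp: coeff_eq_0 not_le)
  finally show ?thesis .
qed

lemma int_adjoin_eval_at: "int_adjoin \<theta> = range (eval_at \<theta>)"
  unfolding int_adjoin_def eval_at_def by auto

lemma int_adjoin_closed:
  assumes "x \<in> int_adjoin \<theta>" "y \<in> int_adjoin \<theta>"
  shows "x + y \<in> int_adjoin \<theta>" "x - y \<in> int_adjoin \<theta>" "x * y \<in> int_adjoin \<theta>"
  using assms unfolding int_adjoin_eval_at image_iff
  by (metis UNIV_I eval_at_add, metis UNIV_I eval_at_diff, metis UNIV_I eval_at_mult)

lemma clear_denominators:
  fixes c :: "rat poly"
  obtains N :: int and u where "N > 0" "smult (of_int N) c = map_poly of_int u"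
proof -
  have "\<exists>N>0. \<exists>u. smult (of_int N) c = map_poly of_int u"
  proof (induction c)
    case 0
    show ?case by (intro exI[of _ 1] conjI exI[of _ 0]) auto
  next
    case (pCons a c)
    then obtain N u where N: "N > 0" "smult (of_int N) c = map_poly of_int u" by blast
    obtain m n where mn: "quotient_of a = (m, n)" by (rule prod.exhaust)
    have n: "n > 0" "a = of_int m / of_int n"
      using quotient_of_denom_pos[OF mn] quotient_of_div[OF mn] by auto
    have "smult (of_int (N * n)) (pCons a c) = pCons (of_int (N * m)) (smult (of_int n) (smult (of_int N) c))"
      using n by (simp add: mult.commute)
    also have "\<dots> = map_poly of_int (pCons (N * m) (smult n u))"
      unfolding N(2) by (simp add: hom_distribs)
    finally show ?case using N(1) n(1) by (intro exI[of _ "N * n"]) auto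
  qed
  then show ?thesis using that by blast
qed

lemma irreducible_bezout:
  fixes G B :: "rat poly"
  assumes "irreducible G" "\<not> G dvd B"
  obtains s t where "s * G + t * B = 1"
proof -
  have "Rings.coprime G B"
    using assms by (simp add: prime_elem_imp_coprime irreducible_imp_prime_elem)
  then have "gcd G B = 1" by (rule coprime_imp_gcd_eq_1)
  then show ?thesis using bezout_coefficients_fst_snd[of G B] by (intro that) (erule trans)
qed

text \<open>The determinant trick: \<open>y\<close> stabilises the additive group spanned by the
  \<open>v i\<close>, so it is an eigenvalue of an integer matrix, whose characteristic polynomial
  is monic. The \<open>v i\<close> may be linearly dependent.\<close>

lemma algebraic_int_eigenvalue:
  fixes v :: "nat \<Rightarrow> complex" and M :: "nat \<Rightarrow> nat \<Rightarrow> int"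
  assumes eq: "\<And>i. i < n \<Longrightarrow> y * v i = (\<Sum>j<n. of_int (M i j) * v j)"
    and nz: "i0 < n" "v i0 \<noteq> 0"
  shows "algebraic_int y"
proof -
  define A where "A = mat n n (\<lambda>(i, j). M i j)"
  define B where "B = map_mat (of_int :: int \<Rightarrow> complex) A"
  have A: "A \<in> carrier_mat n n" and B: "B \<in> carrier_mat n n" unfolding A_def B_def by auto
  have "eigenvector B (vec n v) y"
    unfolding eigenvector_def
  proof (intro conjI)
    show "vec n v \<in> carrier_vec (dim_row B)" using B by auto
    show "vec n v \<noteq> 0\<^sub>v (dim_row B)"
    proof
      assume "vec n v = 0\<^sub>v (dim_row B)"
      then have "vec n v $ i0 = 0" using nz(1) B by auto
      then show False using nz by simp
    qed
    show "B *\<^sub>v vec n v = y \<cdot>\<^sub>v vec n v"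
    proof (rule eq_vecI)
      fix i assume "i < dim_vec (y \<cdot>\<^sub>v vec n v)"
      then have i: "i < n" by simp
      then have "(B *\<^sub>v vec n v) $ i = (\<Sum>j<n. of_int (M i j) * v j)"
        unfolding B_def A_def by (auto simp: scalar_prod_def lessThan_atLeast0)
      then show "(B *\<^sub>v vec n v) $ i = (y \<cdot>\<^sub>v vec n v) $ i" using eq[OF i] i by simp
    qed (use B in auto)
  qed
  then have "poly (char_poly B) y = 0"
    unfolding eigenvalue_root_char_poly[OF B, symmetric] eigenvalue_def by blast
  then have "poly (map_poly of_int (char_poly A)) y = 0"
    unfolding B_def of_int_hom.char_poly_hom[OF A] .
  moreover have "lead_coeff (char_poly A) = 1" using degree_monic_char_poly[OF A] by simp
  ultimately show ?thesis unfolding algebraic_int_altdef_ipoly by blast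
qed

text \<open>Integrality over Z[\<theta>], with coefficients given as polynomials so that the
  equation can be lifted to Z[x] and read modulo \<open>(p, \<phi>)\<close>. For n = 0 the equation
  would say 1 = 0, so n is positive.\<close>

definition integral_over :: "complex \<Rightarrow> complex \<Rightarrow> bool" where
  "integral_over \<theta> z \<longleftrightarrow> (\<exists>n c. z ^ n + (\<Sum>i<n. eval_at \<theta> (c i) * z ^ i) = 0)"

lemma algebraic_int_integral_over:
  assumes "algebraic_int z" shows "integral_over \<theta> z"
proof -
  obtain P where P: "poly (map_poly of_int P) z = 0" "lead_coeff P = 1"
    using assms unfolding algebraic_int_altdef_ipoly by blast
  have "0 = (\<Sum>i\<le>degree P. of_int (coeff P i) * z ^ i)"
    using P(1) by (simp add: poly_altdef)
  also have "\<dots> = z ^ degree P + (\<Sum>i<degree P. of_int (coeff P i) * z ^ i)"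
    using P(2) by (simp flip: lessThan_Suc_atMost add: add.commute)
  finally have "z ^ degree P + (\<Sum>i<degree P. eval_at \<theta> [:coeff P i:] * z ^ i) = 0"
    unfolding eval_at_const by simp
  then show ?thesis unfolding integral_over_def by (intro exI)
qed

text \<open>Scaling by the n-th power of t(\<theta>). As n - i > 0, every lower coefficient acquires
  a factor \<open>t\<close>, which matters when \<open>t\<close> lies in m.\<close>

lemma integral_over_mult_poly:
  assumes "z ^ n + (\<Sum>i<n. eval_at \<theta> (c i) * z ^ i) = 0"
  shows "(eval_at \<theta> t * z) ^ n + (\<Sum>i<n. eval_at \<theta> (c i * t ^ (n - i)) * (eval_at \<theta> t * z) ^ i) = 0"
proof -
  have "eval_at \<theta> (c i * t ^ (n - i)) * (eval_at \<theta> t * z) ^ i = eval_at \<theta> t ^ n * (eval_at \<theta> (c i) * z ^ i)"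
    if "i < n" for i
  proof -
    have "eval_at \<theta> t ^ n = eval_at \<theta> t ^ (n - i) * eval_at \<theta> t ^ i"
      using that by (simp flip: power_add)
    then show ?thesis by (simp add: eval_at_mult eval_at_power power_mult_distrib)
  qed
  then have "(\<Sum>i<n. eval_at \<theta> (c i * t ^ (n - i)) * (eval_at \<theta> t * z) ^ i)
      = eval_at \<theta> t ^ n * (\<Sum>i<n. eval_at \<theta> (c i) * z ^ i)"
    unfolding sum_distrib_left by (intro sum.cong) auto
  then have "(eval_at \<theta> t * z) ^ n + (\<Sum>i<n. eval_at \<theta> (c i * t ^ (n - i)) * (eval_at \<theta> t * z) ^ i)
      = eval_at \<theta> t ^ n * (z ^ n + (\<Sum>i<n. eval_at \<theta> (c i) * z ^ i))"
    by (simp only: power_mult_distrib distrib_left)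
  then show ?thesis using assms by simp
qed

lemma add_index_eq_1_iff:
  assumes "0 \<in> G" "0 \<in> H" "\<And>x y. x \<in> H \<Longrightarrow> y \<in> H \<Longrightarrow> x + y \<in> H" "\<And>x y. x \<in> H \<Longrightarrow> y \<in> H \<Longrightarrow> x - y \<in> H"
  shows "add_index G H = 1 \<longleftrightarrow> G \<subseteq> H"
proof
  assume "add_index G H = 1"
  then obtain S where S: "(\<lambda>x. (+) x ` H) ` G = {S}" 
    unfolding add_index_def by (metis card_1_singletonE)
  show "G \<subseteq> H"
  proof
    fix x assume "x \<in> G"
    have eq: "(+) y ` H = S" if "y \<in> G" for y using imageI[OF that, of "\<lambda>x. (+) x ` H"] S by simp
    have "x + 0 \<in> (+) x ` H" using assms(2) by (rule imageI)
    also have "(+) x ` H = (+) 0 ` H" using eq[OF \<open>x \<in> G\<close>] eq[OF assms(1)] by simp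
    finally show "x \<in> H" by auto
  qed
next
  assume GH: "G \<subseteq> H"
  have "(+) x ` H = H" if "x \<in> G" for x
  proof (intro equalityI subsetI)
    fix y assume "y \<in> H"
    then have "y - x \<in> H" using GH that assms(4) by blast
    then have "x + (y - x) \<in> (+) x ` H" by (rule imageI)
    then show "y \<in> (+) x ` H" by simp
  qed (use GH that assms(3) in blast)
  then have "(\<lambda>x. (+) x ` H) ` G = {H}" using assms(1) by auto
  then show "add_index G H = 1" unfolding add_index_def by simp
qed

section \<open>The order Z[\<theta>] generated by a root of g\<close>

context
  fixes g :: "int poly" and \<theta> :: complex
  assumes monic: "lead_coeff g = 1"
    and irred: "irreducible (map_poly of_int g :: rat poly)"
    and root: "eval_at \<theta> g = 0"
begin

lemma eval_at_of_rat: "poly (map_poly of_rat (map_poly rat_of_int u)) \<theta> = eval_at \<theta> u"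
  unfolding eval_at_def by (simp add: map_poly_map_poly o_def)

lemma degree_pos: "degree g > 0"
proof (rule ccontr)
  assume "\<not> degree g > 0"
  then have "g = 1" using monic monic_degree_0 by blast
  then show False using root by (simp add: eval_at_1)
qed

text \<open>A nonzero remainder vanishing at \<theta> would be coprime to \<open>g\<close> over Q,
  and a Bezout identity evaluated at \<theta> would read 0 = 1.\<close>

lemma eval_at_eq_0D:
  assumes u: "eval_at \<theta> u = 0" shows "g dvd u"
proof -
  obtain q r where qr: "u = g * q + r" "r = 0 \<or> degree r < degree g" using monic_divide[OF monic] .
  have r: "eval_at \<theta> r = 0" using u root unfolding qr by (simp add: eval_at_add eval_at_mult)
  have "r = 0"
  proof (rule ccontr)
    assume r0: "r \<noteq> 0"
    then have "\<not> (map_poly of_int g :: rat poly) dvd map_poly of_int r"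
      using qr(2) dvd_imp_degree_le[of "map_poly of_int g :: rat poly" "map_poly of_int r"] by auto
    then obtain s t where st: "s * map_poly of_int g + t * map_poly of_int r = (1 :: rat poly)"
      using irreducible_bezout[OF irred] by blast
    have "poly (map_poly of_rat (s * map_poly of_int g + t * map_poly of_int r)) \<theta> = 0"
      using r root by (simp add: hom_distribs eval_at_of_rat)
    then show False unfolding st by simp
  qed
  then show ?thesis using qr(1) by simp
qed

text \<open>Inverting the denominator modulo \<open>g\<close> turns the fraction into a rational
  polynomial in \<theta>, whose coefficients have a common denominator.\<close>

lemma rat_adjoin_denominator:
  assumes "x \<in> rat_adjoin \<theta>"
  obtains N where "N > 0" "of_nat N * x \<in> int_adjoin \<theta>"
proof -
  obtain a b :: "rat poly" where x: "x = poly (map_poly of_rat a) \<theta> / poly (map_poly of_rat b) \<theta>"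
    and b: "poly (map_poly of_rat b) \<theta> \<noteq> 0"
    using assms unfolding rat_adjoin_def by blast
  have g0: "poly (map_poly of_rat (map_poly rat_of_int g)) \<theta> = 0" using root eval_at_of_rat by simp
  have "\<not> map_poly of_int g dvd b"
    using b g0 by (auto simp: dvd_def hom_distribs)
  then obtain s t where st: "s * map_poly of_int g + t * b = 1" using irreducible_bezout[OF irred] by blast
  have "poly (map_poly of_rat (s * map_poly of_int g + t * b)) \<theta> = 1" unfolding st by simp
  then have "poly (map_poly of_rat t) \<theta> * poly (map_poly of_rat b) \<theta> = 1"
    using g0 by (simp add: hom_distribs)
  then have x: "x = poly (map_poly of_rat (a * t)) \<theta>"
    unfolding x using b by (simp add: hom_distribs field_simps)
  obtain N u where N: "N > 0" "smult (of_int N) (a * t) = map_poly of_int u" by (rule clear_denominators)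
  have "of_int N * x = poly (map_poly of_rat (smult (of_int N) (a * t))) \<theta>"
    unfolding x by (simp add: hom_distribs)
  also have "\<dots> = eval_at \<theta> u" unfolding N(2) by (rule eval_at_of_rat)
  finally have "of_nat (nat N) * x \<in> int_adjoin \<theta>" using N(1) unfolding int_adjoin_eval_at by simp
  then show ?thesis using N(1) by (intro that[of "nat N"]) auto
qed

lemma eval_at_reduce:
  obtains r where "degree r < degree g" "eval_at \<theta> u = eval_at \<theta> r"
proof -
  obtain q r where qr: "u = g * q + r" "r = 0 \<or> degree r < degree g" using monic_divide[OF monic] .
  then show ?thesis using degree_pos root by (intro that[of r]) (auto simp: eval_at_add eval_at_mult)
qed

text \<open>Write \<open>g = \<phi>^2 a + p \<phi> b + p^2 c\<close> and take y = (\<phi> a + p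
  b)(\<theta>) / p. Then \<phi>(\<theta>) y = - p c(\<theta>), so y multiplies the ideal of
  Z[\<theta>] generated by p and \<phi>(\<theta>) into itself, which makes it integral.\<close>

lemma singular_mod_imp_not_closed:
  assumes sing: "singular_mod p g"
  obtains y where "y \<in> rat_adjoin \<theta>" "algebraic_int y" "y \<notin> int_adjoin \<theta>"
proof -
  obtain \<phi> where m: "maximal_pair (int p) \<phi>" and "g \<in> ideal_pair_sq (int p) \<phi>"
    using sing unfolding singular_mod_def by blast
  then obtain a b c where g: "g = \<phi> * \<phi> * a + [:int p:] * \<phi> * b + [:int p:] * [:int p:] * c"
    by (elim ideal_pair_sqE)
  note M = maximal_pairD[OF m]
  let ?e = "eval_at \<theta>"
  define r where "r = \<phi> * a + [:int p:] * b"
  define y where "y = ?e r / of_nat p"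
  have p0: "p > 0" using M(1) by (simp add: prime_gt_0_nat)
  have py: "of_nat p * y = ?e r" unfolding y_def using p0 by simp
  have "?e g = ?e \<phi> * ?e r + of_nat p * of_nat p * ?e c"
    unfolding g r_def by (simp add: eval_at_add eval_at_mult eval_at_const algebra_simps)
  then have "?e \<phi> * ?e r = of_nat p * (- of_nat p * ?e c)"
    using root by (simp add: eq_neg_iff_add_eq_0 mult.assoc)
  then have "of_nat p * (y * ?e \<phi>) = of_nat p * (- of_nat p * ?e c)"
    unfolding py[symmetric] by (simp only: ac_simps)
  then have y\<phi>: "y * ?e \<phi> = - of_nat p * ?e c" using p0 by (subst (asm) mult_cancel_left) simp
  let ?n = "degree g"
  \<comment> \<open>Additive generators of that ideal: p and \<phi>(\<theta>), each times the powers
    of \<theta> below \<open>degree g\<close>.\<close>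
  define v where "v j = (if j < ?n then of_nat p * \<theta> ^ j else ?e \<phi> * \<theta> ^ (j - ?n))" for j
  have span: "\<exists>M. ?e u = (\<Sum>j<?n + ?n. of_int (M j) * v j)" if "u \<in> ideal_pair (int p) \<phi>" for u
  proof -
    obtain a b where u: "u = [:int p:] * a + \<phi> * b" using \<open>u \<in> ideal_pair (int p) \<phi>\<close> by (elim ideal_pairE)
    obtain a' where a': "degree a' < ?n" "?e a = ?e a'" by (rule eval_at_reduce)
    obtain b' where b': "degree b' < ?n" "?e b = ?e b'" by (rule eval_at_reduce)
    define M where "M j = (if j < ?n then coeff a' j else coeff b' (j - ?n))" for j
    have "?e u = of_nat p * ?e a' + ?e \<phi> * ?e b'"
      unfolding u by (simp add: eval_at_add eval_at_mult eval_at_const a' b')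
    also have "\<dots> = (\<Sum>j<?n. of_int (M j) * v j) + (\<Sum>j<?n. of_int (M (j + ?n)) * v (j + ?n))"
      unfolding eval_at_altdef[OF a'(1)] eval_at_altdef[OF b'(1)] sum_distrib_left M_def v_def
      by (intro arg_cong2[of _ _ _ _ "(+)"] sum.cong) (auto simp: algebra_simps)
    also have "(\<Sum>j<?n. F j) + (\<Sum>j<k. F (j + ?n)) = (\<Sum>j<?n + k. F j)" for F :: "nat \<Rightarrow> complex" and k
      by (induction k) (simp_all add: ac_simps)
    finally show ?thesis by blast
  qed
  have "\<exists>M. y * v i = (\<Sum>j<?n + ?n. of_int (M j) * v j)" for i
  proof (cases "i < ?n")
    case True
    have "y * v i = ?e (r * monom 1 i)"
      unfolding eval_at_mult py[symmetric] v_def using True by (simp add: eval_at_def poly_monom)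
    moreover have "r * monom 1 i \<in> ideal_pair (int p) \<phi>"
      unfolding r_def
      by (intro poly_ideal_mult2[OF poly_ideal_pair] poly_ideal_add[OF poly_ideal_pair] phi_in_ideal_pair p_in_ideal_pair)
    ultimately show ?thesis using span by metis
  next
    case False
    have "y * v i = ?e ([:int p:] * (- c * monom 1 (i - ?n)))"
      using False y\<phi> unfolding v_def
      by (simp add: eval_at_mult eval_at_const eval_at_def poly_monom hom_distribs flip: mult.assoc)
    then show ?thesis
      using span poly_ideal_mult2[OF poly_ideal_pair p_in_ideal_pair] by metis
  qed
  then obtain M where "\<And>i. y * v i = (\<Sum>j<?n + ?n. of_int (M i j) * v j)" by metis
  then have "algebraic_int y"
    using degree_pos p0 by (intro algebraic_int_eigenvalue[of "?n + ?n" y v M 0]) (simp_all add: v_def)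
  moreover have "y \<in> rat_adjoin \<theta>"
    unfolding rat_adjoin_def
    using p0 eval_at_of_rat[of r]
    by (intro CollectI exI[of _ "map_poly of_int r"] exI[of _ "[:of_nat p:]"]) (simp add: y_def)
  moreover have "y \<notin> int_adjoin \<theta>"
  proof
    assume "y \<in> int_adjoin \<theta>"
    then obtain s where s: "y = ?e s" unfolding int_adjoin_eval_at by blast
    have "?e (r - [:int p:] * s) = 0"
      using py unfolding s by (simp add: eval_at_diff eval_at_mult eval_at_const)
    from eval_at_eq_0D[OF this] obtain q where "r - [:int p:] * s = g * q" by (elim dvdE)
    \<comment> \<open>Modulo p this says \<open>\<phi> a (1 - \<phi> q) = 0\<close>. Either p
      divides \<open>a\<close> and hence the monic \<open>g\<close>, or \<open>\<phi>\<close> is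
      invertible modulo p, against properness of m.\<close>
    then have "\<phi> * (a - \<phi> * a * q) = [:int p:] * (s - b + (\<phi> * b + [:int p:] * c) * q)"
      unfolding r_def g by (simp add: algebra_simps)
    then have "[:int p:] dvd \<phi> * (a - \<phi> * a * q)" by (rule dvdI)
    then have "[:int p:] dvd a - \<phi> * a * q" by (rule dvd_of_dvd_mult_monic[OF M(1,2)])
    also have "a - \<phi> * a * q = a * (1 - \<phi> * q)" by (simp add: algebra_simps)
    finally have "[:int p:] dvd a * (1 - \<phi> * q)" .
    then have "[:int p:] dvd a \<or> [:int p:] dvd 1 - \<phi> * q"
      by (rule prime_elem_dvd_multD[OF prime_const_poly[OF M(1)]])
    then show False
    proof
      assume "[:int p:] dvd a"
      then have "[:int p:] dvd g" unfolding g
        by (intro dvd_add dvd_mult2[OF dvd_triv_left] dvd_mult) (simp_all only: mult.assoc dvd_triv_left)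
      then show False using not_prime_dvd_monic[OF M(1) monic] by blast
    next
      assume "[:int p:] dvd 1 - \<phi> * q"
      then obtain w where "1 - \<phi> * q = [:int p:] * w" by (elim dvdE)
      then have "1 = [:int p:] * w + \<phi> * q" by (simp only: diff_eq_eq)
      then show False using M(3) ideal_pairI by blast
    qed
  qed
  ultimately show ?thesis using that by blast
qed

text \<open>The core of Dedekind's criterion. The maximal ideal \<open>(p, \<phi>)\<close> maps \<open>z\<close> into \<open>\<int>[\<theta>]\<close>;
  integrality of \<open>z\<close> forces the image to lie in \<open>(p, \<phi>)\<close> again, since otherwise that ideal
  would be locally principal.\<close>

lemma integral_imp_singular_mod:
  assumes m: "maximal_pair (int p) \<phi>" and g\<phi>: "g \<in> ideal_pair (int p) \<phi>"
    and z: "integral_over \<theta> z" "z \<notin> int_adjoin \<theta>"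
    and pz: "of_nat p * z \<in> int_adjoin \<theta>" and \<phi>z: "eval_at \<theta> \<phi> * z \<in> int_adjoin \<theta>"
  shows "singular_mod p g"
proof -
  note M = maximal_pairD[OF m]
  note I = poly_ideal_pair[of "int p" \<phi>] and J = poly_ideal_pair_sq[of "int p" \<phi>]
  let ?e = "eval_at \<theta>"
  obtain n c where nc: "z ^ n + (\<Sum>i<n. ?e (c i) * z ^ i) = 0" using z(1) unfolding integral_over_def by blast
  \<comment> \<open>Otherwise let \<open>d\<close> invert \<open>r\<close> modulo m and scale the
    integral equation by the n-th power of (u d)(\<theta>). All terms but \<open>(r * d) ^ n\<close>
    carry a factor \<open>u\<close> and lie in m, as does \<open>g\<close>, so \<open>r * d\<close>
    would lie in m.\<close>
  have stable: "r \<in> ideal_pair (int p) \<phi>" if u: "u \<in> ideal_pair (int p) \<phi>" and r: "?e u * z = ?e r" for u r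
  proof (rule ccontr)
    assume "r \<notin> ideal_pair (int p) \<phi>"
    then obtain d where d: "1 - r * d \<in> ideal_pair (int p) \<phi>" using m unfolding maximal_pair_def by blast
    define S where "S = (\<Sum>i<n. c i * (u * d) ^ (n - i) * (r * d) ^ i)"
    have ud: "?e (u * d) * z = ?e (r * d)" using r by (simp add: eval_at_mult)
    have "?e ((r * d) ^ n + S) = 0"
      using integral_over_mult_poly[OF nc, of "u * d"] unfolding S_def ud
      by (simp only: eval_at_add eval_at_sum eval_at_mult eval_at_power)
    from eval_at_eq_0D[OF this] obtain q where q: "(r * d) ^ n + S = g * q" by (elim dvdE)
    have "S \<in> ideal_pair (int p) \<phi>" if "k \<le> n" "S = (\<Sum>i<k. c i * (u * d) ^ (n - i) * (r * d) ^ i)" for k S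
      using that
    proof (induction k arbitrary: S)
      case 0
      then show ?case using poly_ideal_0[OF I] by simp
    next
      case (Suc k)
      have "(u * d) ^ (n - k) = u * (d * (u * d) ^ (n - k - 1))" using Suc.prems(1)
        by (simp add: power_eq_if[of _ "n - k"] mult.assoc)
      then have "c k * (u * d) ^ (n - k) * (r * d) ^ k \<in> ideal_pair (int p) \<phi>"
        using u by (simp only:) (intro poly_ideal_mult2[OF I] poly_ideal_mult[OF I])
      then show ?case using Suc poly_ideal_add[OF I] by simp
    qed
    then have "S \<in> ideal_pair (int p) \<phi>" unfolding S_def by blast
    moreover have "(r * d) ^ n = g * q - S" using q by (simp add: algebra_simps)
    ultimately have "(r * d) ^ n \<in> ideal_pair (int p) \<phi>"
      using poly_ideal_diff[OF I poly_ideal_mult2[OF I g\<phi>]] by metis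
    then have "r * d \<in> ideal_pair (int p) \<phi>" by (rule maximal_pair_power[OF m])
    then have "(1 - r * d) + r * d \<in> ideal_pair (int p) \<phi>" by (rule poly_ideal_add[OF I d])
    then show False using M(3) by simp
  qed
  obtain r1 where r1: "of_nat p * z = ?e r1" using pz unfolding int_adjoin_eval_at by blast
  have "r1 \<in> ideal_pair (int p) \<phi>"
    using stable[OF p_in_ideal_pair] r1 by (simp add: eval_at_const)
  then obtain a s where as: "r1 = [:int p:] * a + \<phi> * s" by (elim ideal_pairE)
  obtain r2 where r2: "?e \<phi> * z = ?e r2" using \<phi>z unfolding int_adjoin_eval_at by blast
  \<comment> \<open>After the shift by a(\<theta>), p (z - a) = \<phi> s and \<phi> (z - a) = p b1 +
    \<phi> b2 at \<theta>. Eliminating z - a puts a multiple \<open>g * c\<close> into m^2.\<close>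
  have "r2 - \<phi> * a \<in> ideal_pair (int p) \<phi>"
    by (intro poly_ideal_diff[OF I] poly_ideal_mult2[OF I] phi_in_ideal_pair stable[OF phi_in_ideal_pair r2])
  then obtain b1 b2 where b: "r2 - \<phi> * a = [:int p:] * b1 + \<phi> * b2" by (elim ideal_pairE)
  have 1: "of_nat p * (z - ?e a) = ?e (\<phi> * s)"
    using r1 unfolding as by (simp add: eval_at_add eval_at_mult eval_at_const algebra_simps)
  have 2: "?e \<phi> * (z - ?e a) = ?e ([:int p:] * b1 + \<phi> * b2)"
    unfolding b[symmetric] by (simp add: eval_at_diff eval_at_mult right_diff_distrib r2)
  have "?e (\<phi> * (\<phi> * s)) = of_nat p * (?e \<phi> * (z - ?e a))"
    unfolding eval_at_mult[of _ _ "\<phi> * s"] 1[symmetric] by simp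
  also have "\<dots> = ?e ([:int p:] * ([:int p:] * b1 + \<phi> * b2))"
    unfolding 2 eval_at_mult[of _ "[:int p:]"] eval_at_const by simp
  finally have "?e (\<phi> * (\<phi> * s) - [:int p:] * ([:int p:] * b1 + \<phi> * b2)) = 0"
    by (simp add: eval_at_diff)
  from eval_at_eq_0D[OF this] obtain c where c: "\<phi> * (\<phi> * s) - [:int p:] * ([:int p:] * b1 + \<phi> * b2) = g * c" by (elim dvdE)
  \<comment> \<open>If \<open>c\<close> were in m, \<open>\<phi>\<close> could be cancelled modulo p
    and z would lie in Z[\<theta>]. So \<open>c\<close> is invertible modulo m, and \<open>g\<close>
    itself falls into m^2.\<close>
  have "c \<notin> ideal_pair (int p) \<phi>"
  proof
    assume "c \<in> ideal_pair (int p) \<phi>"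
    then obtain c1 c2 where c12: "c = [:int p:] * c1 + \<phi> * c2" by (elim ideal_pairE)
    have "\<phi> * (\<phi> * s - g * c2) = [:int p:] * ([:int p:] * b1 + \<phi> * b2 + g * c1)"
      using c unfolding c12 by (simp add: algebra_simps)
    then have "[:int p:] dvd \<phi> * (\<phi> * s - g * c2)" by (rule dvdI)
    then have "[:int p:] dvd \<phi> * s - g * c2" by (rule dvd_of_dvd_mult_monic[OF M(1,2)])
    then obtain e where "\<phi> * s - g * c2 = [:int p:] * e" by (elim dvdE)
    then have "\<phi> * s = [:int p:] * e + g * c2" by (simp only: diff_eq_eq)
    then have "of_nat p * (z - ?e a) = of_nat p * ?e e"
      unfolding 1 using root by (simp add: eval_at_add eval_at_mult eval_at_const)
    moreover have "p \<noteq> 0" using M(1) by auto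
    ultimately have "z - ?e a = ?e e" by simp
    then have "z = ?e (a + e)" by (simp add: eval_at_add algebra_simps)
    then show False using z(2) unfolding int_adjoin_eval_at by blast
  qed
  then obtain d where d: "1 - c * d \<in> ideal_pair (int p) \<phi>" using m unfolding maximal_pair_def by blast
  have "g * c = \<phi> * \<phi> * s - ([:int p:] * [:int p:] * b1 + [:int p:] * \<phi> * b2)"
    unfolding c[symmetric] by (simp add: algebra_simps)
  also have "\<dots> \<in> ideal_pair_sq (int p) \<phi>"
    by (intro poly_ideal_diff[OF J] poly_ideal_add[OF J] poly_ideal_mult2[OF J]
        mult_in_ideal_pair_sq phi_in_ideal_pair p_in_ideal_pair)
  finally have gc: "g * c \<in> ideal_pair_sq (int p) \<phi>" .
  have "g = g * (1 - c * d) + g * c * d" by (simp add: algebra_simps)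
  also have "\<dots> \<in> ideal_pair_sq (int p) \<phi>"
    by (intro poly_ideal_add[OF J] poly_ideal_mult2[OF J gc] mult_in_ideal_pair_sq g\<phi> d)
  finally show ?thesis unfolding singular_mod_def using m by blast
qed

text \<open>The class of \<open>x\<close> modulo Z[\<theta>] is multiplied, without becoming zero,
  until a maximal ideal kills it: an integer factor makes p kill it, then a polynomial factor
  \<open>w'\<close> makes \<open>\<phi>\<close> kill it.\<close>

lemma not_closed_imp_singular_mod:
  assumes x: "x \<in> rat_adjoin \<theta>" "algebraic_int x" "x \<notin> int_adjoin \<theta>"
  obtains p where "prime p" "singular_mod p g"
proof -
  let ?e = "eval_at \<theta>"
  let ?Q = "\<lambda>N. N > 0 \<and> of_nat N * x \<in> int_adjoin \<theta>"
  define N where "N = (LEAST N. ?Q N)"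
  have "\<exists>N. ?Q N" using rat_adjoin_denominator[OF x(1)] by metis
  then have N: "?Q N" unfolding N_def by (rule LeastI_ex)
  have N_min: "N \<le> N'" if "?Q N'" for N' unfolding N_def using that by (rule Least_le)
  have "N \<noteq> 1" using N x(3) by auto
  then obtain p where p: "prime p" "p dvd N" using prime_factor_nat by blast
  then obtain N' where N': "N = p * N'" by (elim dvdE)
  \<comment> \<open>Minimality of the denominator \<open>N\<close> keeps \<open>z\<close> outside
    Z[\<theta>], while p z lies inside.\<close>
  define z where "z = ?e [:int N':] * x"
  have "N' > 0" "N' < N" using N N' prime_gt_1_nat[OF p(1)] by auto
  then have z: "z \<notin> int_adjoin \<theta>" using N_min[of N'] unfolding z_def by (auto simp: eval_at_const)
  have pz: "of_nat p * z \<in> int_adjoin \<theta>" using N unfolding z_def N' by (simp add: eval_at_const mult.assoc)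
  let ?J = "{u. ?e u * z \<in> int_adjoin \<theta>}"
  have "0 \<in> int_adjoin \<theta>" unfolding int_adjoin_eval_at using eval_at_0[of \<theta>] by (metis rangeI)
  then have J: "poly_ideal ?J"
    unfolding poly_ideal_def
    by (auto simp: eval_at_0 eval_at_add eval_at_mult distrib_right mult.assoc int_adjoin_closed
        int_adjoin_eval_at[THEN equalityD2, THEN subsetD] )
  have pJ: "[:int p:] \<in> ?J" and gJ: "g \<in> ?J" and J1: "1 \<notin> ?J"
    using pz z root \<open>0 \<in> int_adjoin \<theta>\<close> by (simp_all add: eval_at_const eval_at_1)
  have p': "prime (int p)" using p(1) by simp
  obtain w where w: "lead_coeff w = 1" "?J = ideal_pair (int p) w"
    using poly_ideal_mod_prime_principal[OF J p' pJ gJ not_prime_dvd_monic[OF p' monic]] .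
  obtain \<phi> where m: "maximal_pair (int p) \<phi>" and sub: "?J \<subseteq> ideal_pair (int p) \<phi>"
    using exists_maximal_pair[OF J p' pJ J1] .
  have "w \<in> ideal_pair (int p) \<phi>" using sub w(2) phi_in_ideal_pair by blast
  \<comment> \<open>Modulo p, \<open>w'\<close> is the cofactor of \<open>\<phi>\<close> in
    \<open>w\<close>. Since \<open>w\<close> and p generate the annihilator of the class of
    \<open>z\<close>, the product \<open>\<phi> * w'\<close> kills that class, but \<open>w'\<close>
    alone does not.\<close>
  then obtain e w' where ew: "w = [:int p:] * e + \<phi> * w'" by (elim ideal_pairE)
  have w'J: "w' \<notin> ?J"
  proof
    assume "w' \<in> ?J"
    then obtain a b where ab: "w' = [:int p:] * a + w * b" unfolding w(2) by (elim ideal_pairE)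
    have "w * (1 - \<phi> * b) = [:int p:] * (e + \<phi> * a)"
      using ew unfolding ab by (simp add: algebra_simps)
    then have "[:int p:] dvd 1 - \<phi> * b" using dvd_of_dvd_mult_monic[OF p' w(1)] by (metis dvd_triv_left)
    then obtain c where "1 - \<phi> * b = [:int p:] * c" by (elim dvdE)
    then have "1 = [:int p:] * c + \<phi> * b" by (simp only: diff_eq_eq)
    then show False using maximal_pairD(3)[OF m] ideal_pairI by blast
  qed
  have "singular_mod p g"
  proof (rule integral_imp_singular_mod[OF m])
    show "g \<in> ideal_pair (int p) \<phi>" using gJ sub by blast
    obtain n c where "x ^ n + (\<Sum>i<n. ?e (c i) * x ^ i) = 0"
      using algebraic_int_integral_over[OF x(2)] unfolding integral_over_def by blast
    note eq = integral_over_mult_poly[OF this, of "w' * [:int N':]"]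
    have "?e (w' * [:int N':]) * x = ?e w' * z" unfolding z_def eval_at_mult by simp
    with eq show "integral_over \<theta> (?e w' * z)" unfolding integral_over_def by metis
    show "?e w' * z \<notin> int_adjoin \<theta>" using w'J by simp
    have "[:int p:] * w' \<in> ?J" by (rule poly_ideal_mult2[OF J pJ])
    then show "of_nat p * (?e w' * z) \<in> int_adjoin \<theta>" by (simp add: eval_at_mult eval_at_const mult.assoc)
    have "\<phi> * w' = w - [:int p:] * e" unfolding ew by simp
    moreover have "w \<in> ?J" unfolding w(2) by (rule phi_in_ideal_pair)
    ultimately have "\<phi> * w' \<in> ?J" using poly_ideal_diff[OF J _ poly_ideal_mult2[OF J pJ]] by metis
    then show "?e \<phi> * (?e w' * z) \<in> int_adjoin \<theta>" by (simp add: eval_at_mult mult.assoc)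
  qed
  then show ?thesis using that p(1) by blast
qed

lemma add_index_eq_1_iff_singular_mod:
  "add_index (ring_of_integers (rat_adjoin \<theta>)) (int_adjoin \<theta>) = 1 \<longleftrightarrow> \<not> (\<exists>p. prime p \<and> singular_mod p g)"
proof -
  have "0 \<in> int_adjoin \<theta>" unfolding int_adjoin_eval_at using eval_at_0[of \<theta>] by (metis rangeI)
  moreover have "0 \<in> rat_adjoin \<theta>"
    unfolding rat_adjoin_def by (intro CollectI exI[of _ 0] exI[of _ 1]) simp
  ultimately have "add_index (ring_of_integers (rat_adjoin \<theta>)) (int_adjoin \<theta>) = 1
      \<longleftrightarrow> ring_of_integers (rat_adjoin \<theta>) \<subseteq> int_adjoin \<theta>"
    by (intro add_index_eq_1_iff int_adjoin_closed) (auto simp: ring_of_integers_def)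
  also have "\<dots> \<longleftrightarrow> \<not> (\<exists>p. prime p \<and> singular_mod p g)"
    unfolding ring_of_integers_def
    using singular_mod_imp_not_closed not_closed_imp_singular_mod by blast
  finally show ?thesis .
qed

end

text \<open>Singularity does not mention the root, so the existential in \<open>monogenic\<close> is
  settled by any root that the fundamental theorem of algebra provides.\<close>

lemma monogenic_iff_singular_mod:
  assumes monic: "lead_coeff g = 1" and irred: "irreducible (map_poly of_int g :: rat poly)"
  shows "monogenic g \<longleftrightarrow> irreducible g \<and> \<not> (\<exists>p. prime p \<and> singular_mod p g)"
proof -
  have "degree g \<noteq> 0"
  proof
    assume "degree g = 0"
    then have "g = 1" using monic monic_degree_0 by blast
    then show False using irred by simp
  qed
  then have "\<not> constant (poly (map_poly complex_of_int g))" by (simp add: constant_degree)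
  then obtain \<theta> where "poly (map_poly of_int g) \<theta> = (0 :: complex)"
    using fundamental_theorem_of_algebra by blast
  then show ?thesis
    using add_index_eq_1_iff_singular_mod[OF monic irred] unfolding monogenic_def eval_at_def
    using monic by blast
qed

section \<open>Irreducibility and monogenicity under \<open>x \<mapsto> x^k\<close>\<close>

lemma irreducible_of_irreducible_rat:
  fixes g :: "int poly"
  assumes monic: "lead_coeff g = 1" and irred: "irreducible (map_poly of_int g :: rat poly)"
  shows "irreducible g"
proof (rule irreducibleI)
  show "g \<noteq> 0" using monic by auto
  show "\<not> is_unit g"
  proof
    assume "is_unit g"
    then have "is_unit (map_poly of_int g :: rat poly)" by (rule of_int_poly_hom.hom_dvd_1)
    then show False using irred by (simp add: irreducible_def)
  qed
next
  fix a b assume g: "g = a * b"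
  have "is_unit c" if c: "is_unit (map_poly of_int c :: rat poly)" "lead_coeff c dvd 1" for c :: "int poly"
  proof -
    have "degree c = 0" using c(1) by (auto simp: is_unit_iff_degree)
    then obtain x where "c = [:x:]" by (rule degree_eq_zeroE)
    then show ?thesis using c(2) by (simp add: is_unit_const_poly_iff)
  qed
  moreover have "is_unit (map_poly of_int a :: rat poly) \<or> is_unit (map_poly of_int b :: rat poly)"
    using irreducibleD[OF irred of_int_poly_hom.hom_mult[of a b, folded g]] .
  moreover have "lead_coeff a dvd 1" "lead_coeff b dvd 1"
    using monic unfolding g lead_coeff_mult by (metis dvd_triv_left, metis dvd_triv_right)
  ultimately show "is_unit a \<or> is_unit b" by blast
qed

text \<open>Substituting x^k respects products and multiplies degrees by k > 0, so it carries a
  factorisation of f to one of f(x^k) and reflects units.\<close>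

lemma irreducible_of_irreducible_subst_power:
  assumes monic: "lead_coeff f = 1" and k: "k > 0"
    and irred: "irreducible (map_poly of_int (subst_power f k) :: rat poly)"
  shows "irreducible (map_poly of_int f :: rat poly)"
proof (rule irreducibleI)
  have hom: "map_poly of_int (subst_power f k) = pcompose (map_poly of_int f :: rat poly) (monom 1 k)"
    unfolding subst_power_def by (simp add: of_int_hom.map_poly_pcompose map_poly_monom)
  have deg: "is_unit (c :: rat poly)" if "is_unit (pcompose c (monom 1 k))" for c
    using that k by (auto simp: is_unit_iff_degree degree_pcompose degree_monom_eq)
  show "map_poly of_int f \<noteq> (0 :: rat poly)" using monic by auto
  show "\<not> is_unit (map_poly of_int f :: rat poly)"
  proof
    assume "is_unit (map_poly of_int f :: rat poly)"
    then have "degree f = 0" using monic by (subst (asm) is_unit_iff_degree) auto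
    moreover have "map_poly of_int (subst_power f k) \<noteq> (0 :: rat poly)" using irred by auto
    ultimately have "is_unit (map_poly of_int (subst_power f k) :: rat poly)"
      by (subst is_unit_iff_degree) (simp_all add: degree_subst_power)
    then show False using irreducible_not_unit[OF irred] by blast
  qed
  fix a b assume ab: "map_poly of_int f = (a * b :: rat poly)"
  have "is_unit (pcompose a (monom 1 k)) \<or> is_unit (pcompose b (monom 1 k))"
    using irreducibleD[OF irred[unfolded hom ab pcompose_mult] refl] .
  then show "is_unit a \<or> is_unit b" using deg by blast
qed

theorem theorem1p9:
  fixes f h :: "int poly" and A :: int and d k :: nat
  assumes "f = monom 1 d + smult A h"
    and "d > 1"
    and "\<bar>poly h 0\<bar> = 1"
    and "degree h < d"
    and "k > 0"
    and "irreducible (map_poly of_int (subst_power f k) :: rat poly)"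
  shows "(\<forall>p. prime p \<and> p dvd k \<longrightarrow> (\<forall>i. int p dvd coeff (test_numerator A h p) i)) \<and>
    (monogenic (subst_power f k) \<longleftrightarrow>
       monogenic f \<and>
       (\<forall>p. prime p \<and> p dvd k \<longrightarrow> poly_mod.coprime_m (int p) (test_poly A h p) f))"
proof (intro conjI)
  show "\<forall>p. prime p \<and> p dvd k \<longrightarrow> (\<forall>i. int p dvd coeff (test_numerator A h p) i)"
    using prime_dvd_test_numerator[OF _ assms(1)] by (simp add: const_poly_dvd_iff)
  have "degree (smult A h) < degree (monom (1 :: int) d)"
    using assms(4) le_less_trans[OF degree_smult_le] by (simp add: degree_monom_eq)
  then have monic: "lead_coeff f = 1"
    using coeff_eq_0[OF assms(4)] unfolding assms(1) by (simp add: degree_add_eq_left degree_monom_eq)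
  have monic_F: "lead_coeff (subst_power f k) = 1"
    using monic lead_coeff_subst_power[OF assms(5)] by simp
  have irred: "irreducible (map_poly of_int f :: rat poly)"
    by (rule irreducible_of_irreducible_subst_power[OF monic assms(5,6)])
  have F: "monogenic (subst_power f k) \<longleftrightarrow> (\<forall>p. prime p \<longrightarrow> \<not> singular_mod p (subst_power f k))"
    using monogenic_iff_singular_mod[OF monic_F assms(6)]
      irreducible_of_irreducible_rat[OF monic_F assms(6)] by blast
  have f: "monogenic f \<longleftrightarrow> (\<forall>p. prime p \<longrightarrow> \<not> singular_mod p f)"
    using monogenic_iff_singular_mod[OF monic irred] irreducible_of_irreducible_rat[OF monic irred] by blast
  show "monogenic (subst_power f k) \<longleftrightarrow> monogenic f \<and>
      (\<forall>p. prime p \<and> p dvd k \<longrightarrow> poly_mod.coprime_m (int p) (test_poly A h p) f)"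
  proof (intro iffI conjI allI impI)
    assume *: "monogenic (subst_power f k)"
    show "monogenic f" using * singular_mod_subst_power[OF _ assms(5)] unfolding F f by blast
    fix p assume p: "prime p \<and> p dvd k"
    then have "\<not> singular_mod p (subst_power f k)" using * unfolding F by blast
    then show "poly_mod.coprime_m (int p) (test_poly A h p) f"
      using singular_mod_subst_power_dvd[OF _ _ assms(5,1), of p] p by simp
  next
    assume *: "monogenic f \<and>
      (\<forall>p. prime p \<and> p dvd k \<longrightarrow> poly_mod.coprime_m (int p) (test_poly A h p) f)"
    show "monogenic (subst_power f k)"
      unfolding F
    proof (intro allI impI)
      fix p :: nat assume p: "prime p"
      show "\<not> singular_mod p (subst_power f k)"
      proof (cases "p dvd k")
        case True
        then show ?thesis using singular_mod_subst_power_dvd[OF p True assms(5,1)] * p by simp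
      next
        case False
        then show ?thesis
          using singular_mod_subst_power_not_dvd[OF assms(1-3) monic assms(5) False] * p unfolding f by blast
      qed
    qed
  qed
qed

end
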